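(* Let $a_1,\ldots,a_r>0$ with $a_1,\ldots,a_{r-1}$ pairwise distinct. Let $0<q_j<1$ for $1\le j\le r$ with $\sum_{j=1}^r q_j=1$, and for each positive integer $n$ let $\vec n=(n_1,\ldots,n_r)$ with $n_j=\lfloor q_jn\rfloor$ (so that $|\vec n|/n\to1$ as $n\to\infty$). For each positive integer $N$ let $C_{\vec n}$ be the multiple Charlier polynomials for the Poisson distributions with parameters $(a_1,a_2,\ldots,a_{r-1},Na_r)$, i.e. the last parameter grows linearly with $N$ (so $C_{\vec n}$ depends on $N$). Then for every $t>0$, $$\lim_{n,N\to\infty,\ n/N\to t}\frac{C_{\vec n+\vec e_r}(Nx)}{N\,C_{\vec n}(Nx)}=g_r(x):=\frac{x-a_r-t+\sqrt{(x-a_r-t)^2-4a_rq_rt}}{2},$$ and for $1\le k<r$, $$\lim_{n,N\to\infty,\ n/N\to t}\frac{C_{\vec n+\vec e_k}(Nx)}{N\,C_{\vec n}(Nx)}=x-t-\frac{a_rq_rt}{g_r(x)},$$ uniformly for $x$ in compact subsets of $\mathbb{C}\setminus[0,\infty)$. Here the square root is the branch, analytic on $\mathbb{C}\setminus[a_r+t-2\sqrt{a_rq_rt},\,a_r+t+2\sqrt{a_rq_rt}]$, that behaves like $x$ as $x\to\infty$.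
   Context: For pairwise distinct $b_1,\ldots,b_r>0$ and a multi-index $\vec n=(n_1,\ldots,n_r)$ of non-negative integers with size $|\vec n|=n_1+\cdots+n_r$, the multiple Charlier polynomial $C_{\vec n}$ with parameters $(b_1,\ldots,b_r)$ is the (unique) monic polynomial of degree $|\vec n|$ such that $$\sum_{k=0}^\infty C_{\vec n}(k)\,k^\ell\,\frac{b_j^k}{k!}=0,\qquad \ell=0,1,\ldots,n_j-1,\quad j=1,\ldots,r$$ (with $k^0=1$ for all $k$, including $k=0$). Its zeros are all real and lie in $(0,\infty)$, so the ratios are well defined for $x\in\mathbb{C}\setminus[0,\infty)$. In the claim $b_j=a_j$ for $j<r$ and $b_r=Na_r$; these are pairwise distinct for all sufficiently large $N$. Here $\vec e_k$ is the $k$th unit vector in $\mathbb{N}^r$. The limit is taken as the positive integers $n,N$ both tend to infinity in such a way that $n/N\to t$. *)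

theory Defs
  imports "HOL-Complex_Analysis.Complex_Analysis" "HOL-Real_Asymp.Real_Asymp"
begin

text \<open>Multi-indices and parameter vectors are functions on \<^typ>\<open>nat\<close>; only the entries with index
  in \<open>{1..r}\<close> matter.\<close>

definition is_multiple_charlier ::
  "nat \<Rightarrow> (nat \<Rightarrow> real) \<Rightarrow> (nat \<Rightarrow> nat) \<Rightarrow> real poly \<Rightarrow> bool" where
  "is_multiple_charlier r b m P \<longleftrightarrow>
     lead_coeff P = 1 \<and> degree P = (\<Sum>j=1..r. m j) \<and>
     (\<forall>j\<in>{1..r}. \<forall>l<m j.
        (\<lambda>k. poly P (real k) * real k ^ l * (b j ^ k / fact k)) sums 0)"

text \<open>Meaningful for pairwise distinct positive \<open>b 1, \<dots>, b r\<close>, where existence and uniqueness hold.\<close>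

definition multiple_charlier :: "nat \<Rightarrow> (nat \<Rightarrow> real) \<Rightarrow> (nat \<Rightarrow> nat) \<Rightarrow> real poly" where
  "multiple_charlier r b m = (THE P. is_multiple_charlier r b m P)"

definition cpoly :: "real poly \<Rightarrow> complex \<Rightarrow> complex" where
  "cpoly P z = poly (map_poly complex_of_real P) z"

definition floor_index :: "(nat \<Rightarrow> real) \<Rightarrow> nat \<Rightarrow> nat \<Rightarrow> nat" where
  "floor_index q n j = nat \<lfloor>q j * real n\<rfloor>"

definition add_unit :: "(nat \<Rightarrow> nat) \<Rightarrow> nat \<Rightarrow> nat \<Rightarrow> nat" where
  "add_unit m k = m(k := m k + 1)"

definition scaled_params :: "nat \<Rightarrow> (nat \<Rightarrow> real) \<Rightarrow> nat \<Rightarrow> nat \<Rightarrow> real" where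
  "scaled_params r a N = a(r := real N * a r)"

definition charlier_ratio ::
  "nat \<Rightarrow> (nat \<Rightarrow> real) \<Rightarrow> (nat \<Rightarrow> real) \<Rightarrow> nat \<Rightarrow> nat \<Rightarrow> nat \<Rightarrow> complex \<Rightarrow> complex" where
  "charlier_ratio r a q k n N x =
     cpoly (multiple_charlier r (scaled_params r a N) (add_unit (floor_index q n) k)) (of_nat N * x) /
     (of_nat N * cpoly (multiple_charlier r (scaled_params r a N) (floor_index q n)) (of_nat N * x))"

text \<open>The filter of pairs \<open>(n, N)\<close> with \<open>n \<rightarrow> \<infinity>\<close>, \<open>N \<rightarrow> \<infinity>\<close> and \<open>n / N \<rightarrow> t\<close>.\<close>

definition ratio_filter :: "real \<Rightarrow> (nat \<times> nat) filter" where
  "ratio_filter t =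
     inf (sequentially \<times>\<^sub>F sequentially) (filtercomap (\<lambda>(n, N). real n / real N) (nhds t))"

lemma filterlim_ratio_filter_iff:
  "filterlim (\<lambda>i. (f i, g i)) (ratio_filter t) F \<longleftrightarrow>
     filterlim f sequentially F \<and> filterlim g sequentially F \<and>
     ((\<lambda>i. real (f i) / real (g i)) \<longlongrightarrow> t) F"
proof -
  have "filterlim (\<lambda>i. (f i, g i)) (sequentially \<times>\<^sub>F sequentially) F \<longleftrightarrow>
      filterlim f sequentially F \<and> filterlim g sequentially F"
  proof
    assume "filterlim (\<lambda>i. (f i, g i)) (sequentially \<times>\<^sub>F sequentially) F"
    from filterlim_compose[OF filterlim_fst this] filterlim_compose[OF filterlim_snd this]
    show "filterlim f sequentially F \<and> filterlim g sequentially F" by simp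
  qed (auto intro: filterlim_Pair)
  then show ?thesis
    unfolding ratio_filter_def filterlim_inf filterlim_filtercomap_iff by (simp add: o_def)
qed

lemma ratio_filter_neq_bot:
  assumes "t > 0"
  shows "ratio_filter t \<noteq> bot"
proof
  assume "ratio_filter t = bot"
  have "filterlim (\<lambda>i. (nat \<lfloor>t * real i\<rfloor>, i)) (ratio_filter t) sequentially"
    unfolding filterlim_ratio_filter_iff
  proof (intro conjI)
    show "filterlim (\<lambda>i. nat \<lfloor>t * real i\<rfloor>) sequentially sequentially"
      using assms by real_asymp
    show "filterlim (\<lambda>i. i) sequentially sequentially" by (rule filterlim_ident)
    have "(\<lambda>i. real_of_int \<lfloor>t * real i\<rfloor> / real i) \<longlonglongrightarrow> t"
      using assms by real_asymp
    then show "(\<lambda>i. real (nat \<lfloor>t * real i\<rfloor>) / real i) \<longlonglongrightarrow> t"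
      using assms by simp
  qed
  then show False
    using \<open>ratio_filter t = bot\<close>
    by (metis bot_unique filterlim_def filtermap_bot_iff sequentially_bot)
qed

definition branch_cut :: "real \<Rightarrow> real \<Rightarrow> complex set" where
  "branch_cut m c = complex_of_real ` {m - 2 * sqrt c .. m + 2 * sqrt c}"

definition is_sqrt_branch :: "real \<Rightarrow> real \<Rightarrow> (complex \<Rightarrow> complex) \<Rightarrow> bool" where
  "is_sqrt_branch m c s \<longleftrightarrow>
     s analytic_on (- branch_cut m c) \<and>
     (\<forall>x\<in>- branch_cut m c. s x ^ 2 = (x - of_real m) ^ 2 - 4 * of_real c) \<and>
     ((\<lambda>x. s x / x) \<longlongrightarrow> 1) at_infinity"

text \<open>By the lemmas below the choice exists and is unique off the cut.\<close>

definition sqrt_branch :: "real \<Rightarrow> real \<Rightarrow> complex \<Rightarrow> complex" where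
  "sqrt_branch m c = (SOME s. is_sqrt_branch m c s)"

lemma mem_branch_cutI:
  assumes "c > 0" "(x - of_real m) ^ 2 = complex_of_real u" "0 \<le> u" "u \<le> 4 * c"
  shows "x \<in> branch_cut m c"
proof -
  define v where "v = sqrt u"
  have "(x - of_real m) ^ 2 = complex_of_real v ^ 2"
    using assms by (simp add: v_def flip: of_real_power)
  then have "x - of_real m = of_real v \<or> x - of_real m = - of_real v"
    by (simp add: power2_eq_iff)
  then have "x = of_real (m + v) \<or> x = of_real (m - v)"
    by (auto simp: algebra_simps)
  moreover have "sqrt u \<le> sqrt (4 * c)" using assms(4) by (rule real_sqrt_le_mono)
  then have "v \<le> 2 * sqrt c" "v \<ge> 0"
    using assms(3) by (simp_all add: v_def real_sqrt_mult)
  ultimately show ?thesis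
    by (auto simp: branch_cut_def simp del: of_real_add of_real_diff)
qed

lemma is_sqrt_branch_exists:
  assumes "c > 0"
  shows "\<exists>s. is_sqrt_branch m c s"
proof -
  define M where "M = complex_of_real m"
  define s where "s = (\<lambda>x::complex. (x - M) * csqrt (1 - 4 * of_real c / (x - M) ^ 2))"
  have nz: "x - M \<noteq> 0" if "x \<in> - branch_cut m c" for x
    using mem_branch_cutI[of c x m 0] that assms by (auto simp: M_def)
  have nonpos: "1 - 4 * of_real c / (x - M) ^ 2 \<notin> \<real>\<^sub>\<le>\<^sub>0" if x: "x \<in> - branch_cut m c" for x
  proof
    assume "1 - 4 * of_real c / (x - M) ^ 2 \<in> \<real>\<^sub>\<le>\<^sub>0"
    then obtain y where y: "1 - 4 * of_real c / (x - M) ^ 2 = complex_of_real y" "y \<le> 0"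
      by (elim nonpos_Reals_cases) auto
    have "4 * of_real c / (x - M) ^ 2 = complex_of_real (1 - y)"
      using y(1) by (simp add: algebra_simps)
    then have "4 * of_real c = complex_of_real (1 - y) * (x - M) ^ 2"
      using nz[OF x] by (simp add: field_simps)
    moreover have "complex_of_real (1 - y) \<noteq> 0"
      using y(2) by (simp del: of_real_diff)
    ultimately have "(x - M) ^ 2 = complex_of_real (4 * c / (1 - y))"
      by (simp add: field_simps)
    moreover have "4 * c / (1 - y) \<le> 4 * c" using y(2) assms by (simp add: field_simps mult_nonneg_nonpos)
    moreover have "0 \<le> 4 * c / (1 - y)" using y(2) assms by simp
    ultimately have "x \<in> branch_cut m c"
      using mem_branch_cutI[OF assms] unfolding M_def by blast
    then show False using x by simp
  qed
  have "closed (branch_cut m c)"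
    unfolding branch_cut_def
    by (intro compact_imp_closed compact_continuous_image continuous_intros) auto
  then have "open (- branch_cut m c)" by (simp add: open_Compl)
  moreover have "s holomorphic_on (- branch_cut m c)"
    unfolding s_def using nz nonpos by (auto intro!: holomorphic_intros)
  ultimately have an: "s analytic_on (- branch_cut m c)" by (simp add: analytic_on_open)
  have sq: "s x ^ 2 = (x - of_real m) ^ 2 - 4 * of_real c" if "x \<in> - branch_cut m c" for x
  proof -
    have "s x ^ 2 = (x - M) ^ 2 * (1 - 4 * of_real c / (x - M) ^ 2)"
      by (simp add: s_def power_mult_distrib)
    also have "\<dots> = (x - M) ^ 2 - 4 * of_real c"
      using nz[OF that] by (simp add: right_diff_distrib)
    finally show ?thesis by (simp add: M_def)
  qed
  have inv: "((\<lambda>x::complex. inverse x) \<longlongrightarrow> 0) at_infinity" by (rule tendsto_inverse_0)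
  have "filterlim (\<lambda>x::complex. x - M) at_infinity at_infinity"
    using tendsto_add_filterlim_at_infinity'[OF filterlim_ident tendsto_const[of "-M"]] by simp
  from filterlim_compose[OF tendsto_inverse_0 this]
  have inv2: "((\<lambda>x. inverse (x - M)) \<longlongrightarrow> 0) at_infinity" by simp
  have "((\<lambda>x. (1 - M * inverse x) * csqrt (1 - 4 * of_real c * inverse (x - M) ^ 2))
      \<longlongrightarrow> (1 - M * 0) * csqrt (1 - 4 * of_real c * 0 ^ 2)) at_infinity"
    by (intro tendsto_intros inv inv2 continuous_at_csqrt[THEN isCont_tendsto_compose]) auto
  then have "((\<lambda>x. (1 - M * inverse x) * csqrt (1 - 4 * of_real c * inverse (x - M) ^ 2))
      \<longlongrightarrow> 1) at_infinity" by simp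
  moreover have "\<forall>\<^sub>F x in at_infinity. (1 - M * inverse x) *
      csqrt (1 - 4 * of_real c * inverse (x - M) ^ 2) = s x / x"
    using eventually_not_equal_at_infinity[of 0]
    by eventually_elim (simp add: s_def field_simps)
  ultimately have "((\<lambda>x. s x / x) \<longlongrightarrow> 1) at_infinity"
    by (rule Lim_transform_eventually)
  then show ?thesis using an sq unfolding is_sqrt_branch_def by blast
qed

lemma is_sqrt_branch_sqrt_branch: "c > 0 \<Longrightarrow> is_sqrt_branch m c (sqrt_branch m c)"
  unfolding sqrt_branch_def using is_sqrt_branch_exists by (rule someI_ex)

lemma is_sqrt_branch_unique:
  assumes "c > 0" "is_sqrt_branch m c s" "is_sqrt_branch m c s'" "x \<in> - branch_cut m c"
  shows "s x = s' x"
proof -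
  let ?D = "- branch_cut m c"
  have bdd: "bounded (branch_cut m c)"
    unfolding branch_cut_def
    by (intro compact_imp_bounded compact_continuous_image continuous_intros) auto
  have nz: "s' y \<noteq> 0" if "y \<in> ?D" for y
  proof
    assume "s' y = 0"
    moreover have "s' y ^ 2 = (y - of_real m) ^ 2 - 4 * of_real c"
      using assms(3) that by (simp add: is_sqrt_branch_def)
    ultimately have "(y - of_real m) ^ 2 = complex_of_real (4 * c)" by simp
    then show False using mem_branch_cutI[of c y m "4 * c"] assms(1) that by simp
  qed
  have pm: "s y / s' y = 1 \<or> s y / s' y = -1" if "y \<in> ?D" for y
  proof -
    have "s y ^ 2 = s' y ^ 2" using assms(2,3) that by (simp add: is_sqrt_branch_def)
    then show ?thesis using nz[OF that] by (auto simp: power2_eq_iff)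
  qed
  have "convex (branch_cut m c)"
    unfolding branch_cut_def by (intro convex_linear_image) (auto simp: linear_iff scaleR_conv_of_real)
  then have conn: "connected ?D"
    using connected_complement_bounded_convex[OF bdd] by (simp add: DIM_complex)
  have cont: "continuous_on ?D (\<lambda>y. s y / s' y)"
    using assms(2,3) nz unfolding is_sqrt_branch_def
    by (intro continuous_intros) (auto intro: holomorphic_on_imp_continuous_on analytic_imp_holomorphic)
  have "finite ((\<lambda>y. s y / s' y) ` ?D)"
    by (rule finite_subset[of _ "{1, -1}"]) (use pm in blast, simp)
  then have "(\<lambda>y. s y / s' y) constant_on ?D"
    using continuous_finite_range_constant[OF conn cont] by blast
  then obtain k where k: "\<And>y. y \<in> ?D \<Longrightarrow> s y / s' y = k"
    unfolding constant_on_def by blast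
  have "((\<lambda>y. (s y / y) / (s' y / y)) \<longlongrightarrow> 1 / 1) at_infinity"
    using assms(2,3) unfolding is_sqrt_branch_def by (intro tendsto_divide) auto
  moreover obtain B where B: "\<And>y. y \<in> branch_cut m c \<Longrightarrow> norm y \<le> B"
    using bdd unfolding bounded_iff by blast
  have "\<forall>\<^sub>F y in at_infinity. y \<in> ?D"
    unfolding eventually_at_infinity by (rule exI[of _ "B + 1"]) (use B in fastforce)
  then have "\<forall>\<^sub>F y in at_infinity. (s y / y) / (s' y / y) = k"
    using eventually_not_equal_at_infinity[of 0]
    by eventually_elim (use k in auto)
  ultimately have "((\<lambda>y::complex. k) \<longlongrightarrow> 1) at_infinity"
    using Lim_transform_eventually by fastforce
  then have "k = 1" using tendsto_const_iff[OF trivial_limit_at_infinity] by blast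
  then show ?thesis using k[OF assms(4)] nz[OF assms(4)] by simp
qed

definition g_limit :: "nat \<Rightarrow> (nat \<Rightarrow> real) \<Rightarrow> (nat \<Rightarrow> real) \<Rightarrow> real \<Rightarrow> complex \<Rightarrow> complex" where
  "g_limit r a q t x =
     (x - of_real (a r) - of_real t + sqrt_branch (a r + t) (a r * q r * t) x) / 2"

end

theory Submission
  imports Defs
begin

text \<open>
  The whole proof runs on the nearest-neighbour recurrence
  \<open>z C(n)(z) = C(n+e\<^sub>k)(z) + (b\<^sub>k + |n|) C(n)(z) + \<Sum>\<^sub>j n\<^sub>j b\<^sub>j C(n-e\<^sub>j)(z)\<close>,
  read as a relation between the quotients \<open>F\<^sub>k(n) = C(n+e\<^sub>k) / C(n)\<close> (lemma
  \<open>charlier_quot_recurrence\<close>):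
  \<open>F\<^sub>k(n) = z - (b\<^sub>k + |n|) - \<Sum>\<^sub>j n\<^sub>j b\<^sub>j / F\<^sub>j(n - e\<^sub>j)\<close>.

  \<^item> The recurrence comes from an umbral description of the polynomials. Let \<open>umbral\<close> be the
    linear map taking \<open>s\<^sup>m\<close> to the falling factorial \<open>x (x-1) \<dots> (x-m+1)\<close>. The mean of a falling
    factorial under a Poisson distribution with parameter \<open>b\<close> is \<open>b\<^sup>m\<close>, so the orthogonality
    conditions on \<open>umbral p\<close> say that \<open>p\<close> vanishes to order \<open>n\<^sub>j\<close> at each \<open>b\<^sub>j\<close>. Hence
    \<open>C(n)\<close> is the image of \<open>\<Prod>\<^sub>j (s - b\<^sub>j) ^ n\<^sub>j\<close> (\<open>multiple_charlier_eq\<close>). Multiplication by \<open>x\<close>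
    corresponds to \<open>p \<mapsto> s (p + p')\<close>, and the recurrence is the product rule.

  \<^item> Taking reciprocals exchanges the upper and the lower half-plane, and a quotient with
    \<open>|F\<^sub>j| \<ge> b\<^sub>j\<close> contributes at most \<open>n\<^sub>j\<close> to the sum. Hence, by induction on \<open>|n|\<close>, the quotient
    \<open>F\<^sub>k(n)\<close> lies at least as far from the real axis as \<open>z\<close>, on the same side; and if
    \<open>Re z \<le> 0\<close>, then \<open>Re F\<^sub>k(n) \<le> Re z - b\<^sub>k\<close> (\<open>charlier_quot_Im\<close>, \<open>charlier_quot_Re\<close>). This shows
    that \<open>C(n)\<close> does not vanish off the half-line, and it bounds all scaled quotients
    \<open>A = F(N x) / N\<close> away from \<open>0\<close>, locally uniformly in \<open>x\<close> and uniformly in \<open>n\<close> and \<open>N\<close>.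

  \<^item> With the last parameter equal to \<open>N a\<^sub>r\<close>, only the term \<open>j = r\<close> of the sum survives the
    scaling, and in the limit \<open>A\<^sub>r(n)\<close> is the image of \<open>A\<^sub>r(n - e\<^sub>r)\<close> under the Moebius map
    \<open>z \<mapsto> x - m - c / z\<close> with \<open>m = a\<^sub>r + t\<close> and \<open>c = a\<^sub>r q\<^sub>r t\<close>. Its fixed points are \<open>g = g_limit\<close>
    and \<open>h = c / g\<close>, with \<open>|h| < |g|\<close> off the branch cut. The coordinate \<open>w = (A - g) / (A - h)\<close>
    is multiplied by \<open>h / g\<close> in each step, up to a small error (\<open>mobius_contraction\<close>). The
    half-plane bounds that keep \<open>A\<close> away from \<open>0\<close> also keep it away from the repelling point \<open>h\<close>
    (\<open>scaled_quot_separated\<close>), so that \<open>w\<close> is bounded from the start and can be iterated down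
    to \<open>0\<close>. This gives \<open>A\<^sub>r \<rightarrow> g\<close>; one more use of the recurrence gives the limit for \<open>k < r\<close>.
\<close>

section \<open>The umbral map\<close>

text \<open>The linear map taking \<open>s\<^sup>m\<close> to the falling factorial of degree \<open>m\<close>, in the Horner form
  \<open>a + s p(s) \<mapsto> a + x P(x - 1)\<close>, where \<open>p \<mapsto> P\<close>. This form lets all of its properties be proved by
  induction over \<^const>\<open>pCons\<close>.\<close>

definition umbral :: "real poly \<Rightarrow> real poly" where
  "umbral p = fold_coeffs (\<lambda>a P. pCons a (pcompose P [:-1, 1:])) p 0"

lemma umbral_0 [simp]: "umbral 0 = 0"
  by (simp add: umbral_def)

lemma umbral_pCons [simp]: "umbral (pCons a p) = pCons a (pcompose (umbral p) [:-1, 1:])"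
  by (cases "p = 0 \<and> a = 0") (auto simp: umbral_def)

lemma umbral_add: "umbral (p + q) = umbral p + umbral q"
  by (induction p q rule: poly_induct2) (simp_all add: pcompose_add)

lemma umbral_smult: "umbral (smult c p) = smult c (umbral p)"
  by (induction p) (simp_all add: pcompose_smult)

lemma umbral_sum: "umbral (sum f A) = (\<Sum>i\<in>A. umbral (f i))"
  by (induction A rule: infinite_finite_induct) (simp_all add: umbral_add)

lemma pcompose_shift_inverse:
  fixes P :: "real poly"
  shows "pcompose (pcompose P [:1, 1:]) [:-1, 1:] = P"
    and "pcompose (pcompose P [:-1, 1:]) [:1, 1:] = P"
  by (simp_all add: pcompose_assoc [symmetric] pcompose_pCons pcompose_idR)

lemma degree_lead_coeff_umbral:
  "degree (umbral p) = degree p \<and> lead_coeff (umbral p) = lead_coeff p"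
proof (induction p)
  case (pCons a p)
  show ?case
  proof (cases "p = 0")
    case False
    then have "umbral p \<noteq> 0" using pCons.IH by (metis leading_coeff_0_iff)
    moreover have "lead_coeff (pcompose (umbral p) [:-1, 1:]) = lead_coeff (umbral p)"
      by (subst lead_coeff_comp) auto
    ultimately show ?thesis using False pCons.IH
      by (auto simp: degree_pcompose pcompose_eq_0_iff)
  qed simp
qed simp

lemma umbral_surj: "\<exists>p. umbral p = P"
proof (induction "degree P" arbitrary: P rule: less_induct)
  case less
  obtain a R where P: "P = pCons a R" by (cases P)
  show ?case
  proof (cases "R = 0")
    case True
    then have "umbral [:a:] = P" by (simp add: P)
    then show ?thesis ..
  next
    case False
    then have "degree (pcompose R [:1, 1:]) < degree P" by (simp add: P degree_pcompose)
    from less[OF this] obtain p where "umbral p = pcompose R [:1, 1:]" by blast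
    then have "umbral (pCons a p) = P" by (simp add: P pcompose_shift_inverse)
    then show ?thesis ..
  qed
qed

text \<open>The forward difference of a falling factorial is the derivative of the corresponding
  power, so the shift by \<open>1\<close> on the image side is \<open>1 + D\<close>.\<close>

lemma umbral_shift: "pcompose (umbral p) [:1, 1:] = umbral (p + pderiv p)"
proof (induction p)
  case (pCons a p)
  have "umbral (pCons a p + pderiv (pCons a p)) = pCons a (pcompose (umbral (p + pderiv p)) [:-1, 1:]) + umbral p"
    by (simp add: pderiv_pCons umbral_add pcompose_add)
  also have "\<dots> = pCons a (umbral p) + umbral p"
    unfolding pCons.IH[symmetric] by (simp add: pcompose_shift_inverse)
  finally show ?case
    by (simp add: pcompose_pCons pcompose_shift_inverse)
qed simp

text \<open>What multiplication by \<open>x\<close> becomes before the umbral map: multiplying a falling factorial of degree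
  \<open>m\<close> by \<open>x = (x - m) + m\<close> raises its degree by one and adds \<open>m\<close> copies of it.\<close>

definition mult_X_dual :: "real poly \<Rightarrow> real poly" where
  "mult_X_dual p = pCons 0 (p + pderiv p)"

lemma umbral_mult_X_dual: "umbral (mult_X_dual p) = pCons 0 (umbral p)"
  by (simp add: mult_X_dual_def umbral_shift[symmetric] pcompose_shift_inverse)

lemma poly_umbral_mult_X_dual_power:
  "poly (umbral ((mult_X_dual ^^ l) p)) x = poly (umbral p) x * x ^ l"
  by (induction l) (simp_all add: umbral_mult_X_dual)

text \<open>A falling factorial cancels against \<open>k!\<close>: the sum over \<open>k\<close> becomes a shifted exponential
  series. In Horner form this is one index shift.\<close>

lemma umbral_sums:
  "(\<lambda>k. poly (umbral p) (real k) * (b ^ k / fact k)) sums (exp b * poly p b)"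
proof (induction p)
  case (pCons a p)
  have "(\<lambda>k. a * (b ^ k / fact k)) sums (a * exp b)"
    by (intro sums_mult) (use exp_converges[of b] in \<open>simp add: field_simps scaleR_conv_of_real\<close>)
  moreover have "(\<lambda>k. real k * poly (umbral p) (real k - 1) * (b ^ k / fact k)) sums
      (b * (exp b * poly p b))"
  proof -
    have "real (Suc k) * poly (umbral p) (real (Suc k) - 1) * (b ^ Suc k / fact (Suc k)) =
        b * (poly (umbral p) (real k) * (b ^ k / fact k))" for k
    proof -
      have "real (Suc k) * (b ^ Suc k / fact (Suc k)) = b * (b ^ k / fact k)"
        by (simp del: of_nat_Suc)
      then show ?thesis by simp
    qed
    then show ?thesis
      using sums_mult[OF pCons.IH, of b]
        sums_Suc_iff[where s = "b * (exp b * poly p b)" and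
          f = "\<lambda>k. real k * poly (umbral p) (real k - 1) * (b ^ k / fact k)"]
      by (simp only:) simp
  qed
  ultimately show ?case
    using sums_add[of "\<lambda>k. a * (b ^ k / fact k)" "a * exp b"
        "\<lambda>k. real k * poly (umbral p) (real k - 1) * (b ^ k / fact k)" "b * (exp b * poly p b)"]
    by (simp add: poly_pcompose algebra_simps)
qed simp

lemma umbral_moment_sums:
  "(\<lambda>k. poly (umbral p) (real k) * real k ^ l * (b ^ k / fact k)) sums
     (exp b * poly ((mult_X_dual ^^ l) p) b)"
  using umbral_sums[of "(mult_X_dual ^^ l) p" b] by (simp add: poly_umbral_mult_X_dual_power)

text \<open>Each application of \<^const>\<open>mult_X_dual\<close> lowers the order of the zero at \<open>b\<close> by one and multiplies
  the leading Taylor coefficient by \<open>b\<close> times the order. For \<open>b \<noteq> 0\<close> the moments of \<open>umbral p\<close> thus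
  detect the exact order of the zero of \<open>p\<close>.\<close>

lemma mult_X_dual_power_root:
  "poly ((mult_X_dual ^^ l) ([:-b, 1:] ^ l * u)) b = b ^ l * fact l * poly u b"
proof (induction l arbitrary: u)
  case (Suc l)
  let ?s = "[:-b, 1:]"
  \<comment> \<open>The cofactor of the lowered power; its value at \<open>b\<close> is \<open>b (l + 1) u(b)\<close>.\<close>
  define v where "v = pCons 0 (?s * u + smult (real (Suc l)) u + ?s * pderiv u)"
  have "mult_X_dual (?s ^ Suc l * u) = [:0, 1:] * (?s ^ Suc l * u + pderiv (?s ^ Suc l * u))"
    by (simp add: mult_X_dual_def)
  also have "pderiv (?s ^ Suc l * u) = ?s ^ l * smult (real (Suc l)) u + ?s ^ Suc l * pderiv u"
    by (simp add: pderiv_mult pderiv_power_Suc pderiv_pCons algebra_simps del: power_Suc of_nat_Suc)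
  also have "[:0, 1:] * (?s ^ Suc l * u + \<dots>) = ?s ^ l * v"
    by (simp add: v_def algebra_simps smult_add_right)
  finally have "mult_X_dual (?s ^ Suc l * u) = ?s ^ l * v" .
  then have "poly ((mult_X_dual ^^ Suc l) (?s ^ Suc l * u)) b = b ^ l * fact l * poly v b"
    using Suc.IH[of v] by (simp only: funpow_Suc_right o_apply)
  then show ?case by (simp add: v_def algebra_simps)
qed simp

lemma root_power_dvd_iff_moments_vanish:
  assumes "b \<noteq> 0"
  shows "[:-b, 1:] ^ m dvd p \<longleftrightarrow> (\<forall>l<m. poly ((mult_X_dual ^^ l) p) b = 0)"
proof
  assume "[:-b, 1:] ^ m dvd p"
  then obtain u where p: "p = [:-b, 1:] ^ m * u" by (elim dvdE)
  have "poly ((mult_X_dual ^^ l) p) b = 0" if "l < m" for l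
  proof -
    have "p = [:-b, 1:] ^ l * ([:-b, 1:] ^ (m - l) * u)"
      using that by (simp add: p mult.assoc[symmetric] flip: power_add)
    then have "poly ((mult_X_dual ^^ l) p) b = b ^ l * fact l * poly ([:-b, 1:] ^ (m - l) * u) b"
      using mult_X_dual_power_root by metis
    then show ?thesis using that by (simp add: poly_power)
  qed
  then show "\<forall>l<m. poly ((mult_X_dual ^^ l) p) b = 0" by blast
next
  assume vanish: "\<forall>l<m. poly ((mult_X_dual ^^ l) p) b = 0"
  show "[:-b, 1:] ^ m dvd p"
  proof (cases "p = 0")
    case False
    then obtain u where p: "p = [:-b, 1:] ^ order b p * u" and u: "\<not> [:-b, 1:] dvd u"
      using order_decomp by blast
    have "poly ((mult_X_dual ^^ order b p) p) b = b ^ order b p * fact (order b p) * poly u b"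
      using mult_X_dual_power_root[of "order b p" b u] p by simp
    then have "\<not> order b p < m"
      using vanish u assms by (metis poly_eq_0_iff_dvd fact_nonzero mult_eq_0_iff power_not_zero)
    then show ?thesis using le_imp_power_dvd order_1 dvd_trans by (metis leI)
  qed simp
qed

section \<open>Multiple Charlier polynomials\<close>

definition node_poly :: "nat \<Rightarrow> (nat \<Rightarrow> real) \<Rightarrow> (nat \<Rightarrow> nat) \<Rightarrow> real poly" where
  "node_poly r b n = (\<Prod>j=1..r. [:-b j, 1:] ^ n j)"

lemma degree_node_poly: "degree (node_poly r b n) = (\<Sum>j=1..r. n j)"
  unfolding node_poly_def by (subst degree_prod_eq_sum_degree) (auto simp: degree_power_eq)

lemma lead_coeff_node_poly: "lead_coeff (node_poly r b n) = 1"
  unfolding node_poly_def by (simp add: lead_coeff_prod lead_coeff_power)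

lemma node_poly_dvdI:
  assumes inj: "inj_on b {1..r}" and dvd: "\<And>j. j \<in> {1..r} \<Longrightarrow> [:-b j, 1:] ^ n j dvd p"
  shows "node_poly r b n dvd p"
proof (cases "p = 0")
  case False
  have "(\<Prod>j\<in>A. [:-b j, 1:] ^ n j) dvd p" if "finite A" "A \<subseteq> {1..r}" for A
    using that
  proof (induction A rule: finite_induct)
    case (insert i A)
    let ?P = "\<Prod>j\<in>A. [:-b j, 1:] ^ n j"
    obtain u where u: "p = ?P * u" using insert by (auto elim: dvdE)
    have nz: "?P \<noteq> 0" "u \<noteq> 0" using False u by auto
    have "poly ?P (b i) \<noteq> 0"
      using insert.hyps insert.prems inj by (auto simp: poly_prod poly_power dest: inj_onD)
    then have "order (b i) ?P = 0" by (rule order_0I)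
    then have "order (b i) p = order (b i) u"
      using order_mult[of ?P u "b i"] nz by (simp add: u)
    moreover have "n i \<le> order (b i) p"
      using dvd[of i] insert.prems False by (simp add: order_divides)
    ultimately have "[:-b i, 1:] ^ n i dvd u" by (simp add: order_divides)
    then show ?case using insert.hyps by (simp add: u mult.commute)
  qed simp
  then show ?thesis by (simp add: node_poly_def)
qed simp

lemma monic_dvd_same_degree_eq:
  fixes p q :: "real poly"
  assumes "p dvd q" "lead_coeff p = 1" "lead_coeff q = 1" "degree p = degree q"
  shows "p = q"
proof -
  obtain u where u: "q = p * u" using assms(1) by (elim dvdE)
  have "p \<noteq> 0" "u \<noteq> 0" using assms u by auto
  then have "degree u = 0" using assms(4) u by (simp add: degree_mult_eq)
  then obtain c where "u = [:c:]" by (elim degree_eq_zeroE)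
  then show ?thesis using assms(2,3) u by (simp split: if_splits)
qed

definition charlier :: "nat \<Rightarrow> (nat \<Rightarrow> real) \<Rightarrow> (nat \<Rightarrow> nat) \<Rightarrow> real poly" where
  "charlier r b n = umbral (node_poly r b n)"

text \<open>Since \<^const>\<open>umbral\<close> is onto, every candidate is \<open>umbral p\<close>; orthogonality makes the node
  polynomial divide \<open>p\<close>, and both are monic of the same degree. This gives existence and uniqueness
  at once.\<close>

lemma is_multiple_charlier_iff:
  assumes pos: "\<And>j. j \<in> {1..r} \<Longrightarrow> b j > 0" and inj: "inj_on b {1..r}"
  shows "is_multiple_charlier r b n P \<longleftrightarrow> P = charlier r b n"
proof -
  have orth: "(\<forall>j\<in>{1..r}. \<forall>l<n j.
        (\<lambda>k. poly (umbral p) (real k) * real k ^ l * (b j ^ k / fact k)) sums 0) \<longleftrightarrow>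
      (\<forall>j\<in>{1..r}. [:-b j, 1:] ^ n j dvd p)" for p
  proof -
    have "(\<lambda>k. poly (umbral p) (real k) * real k ^ l * (b j ^ k / fact k)) sums 0 \<longleftrightarrow>
        poly ((mult_X_dual ^^ l) p) (b j) = 0" for j l
      using umbral_moment_sums[of p l "b j"] sums_unique2[OF umbral_moment_sums[of p l "b j"], of 0]
      by auto
    moreover have "b j \<noteq> 0" if "j \<in> {1..r}" for j using pos[OF that] by simp
    ultimately show ?thesis by (simp add: root_power_dvd_iff_moments_vanish)
  qed
  show ?thesis
  proof
    assume P: "is_multiple_charlier r b n P"
    obtain p where p: "P = umbral p" using umbral_surj[of P] by auto
    have "node_poly r b n dvd p"
      using P unfolding is_multiple_charlier_def p orth by (intro node_poly_dvdI inj) auto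
    then have "node_poly r b n = p"
    proof (rule monic_dvd_same_degree_eq[OF _ lead_coeff_node_poly])
      show "lead_coeff p = 1" "degree (node_poly r b n) = degree p"
        using P degree_lead_coeff_umbral[of p]
        unfolding is_multiple_charlier_def p degree_node_poly by metis+
    qed
    then show "P = charlier r b n" by (simp add: p charlier_def)
  next
    assume P: "P = charlier r b n"
    have "[:-b j, 1:] ^ n j dvd node_poly r b n" if "j \<in> {1..r}" for j
      unfolding node_poly_def using that by (intro dvd_prodI) auto
    moreover have "degree (umbral (node_poly r b n)) = (\<Sum>j=1..r. n j)"
        "lead_coeff (umbral (node_poly r b n)) = 1"
      using degree_lead_coeff_umbral[of "node_poly r b n"] degree_node_poly[of r b n]
        lead_coeff_node_poly[of r b n] by metis+
    ultimately show "is_multiple_charlier r b n P"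
      unfolding is_multiple_charlier_def P charlier_def orth by blast
  qed
qed

lemma multiple_charlier_eq:
  assumes "\<And>j. j \<in> {1..r} \<Longrightarrow> b j > 0" "inj_on b {1..r}"
  shows "multiple_charlier r b n = charlier r b n"
  unfolding multiple_charlier_def
  using is_multiple_charlier_iff[where b = b, OF assms] by (intro the_equality) auto

definition drop_unit :: "(nat \<Rightarrow> nat) \<Rightarrow> nat \<Rightarrow> nat \<Rightarrow> nat" where
  "drop_unit n k = n(k := n k - 1)"

lemma node_poly_remove:
  assumes "k \<in> {1..r}"
  shows "node_poly r b n = [:-b k, 1:] ^ n k * (\<Prod>j\<in>{1..r} - {k}. [:-b j, 1:] ^ n j)"
  unfolding node_poly_def using assms by (simp add: prod.remove)

lemma node_poly_add_unit:
  assumes "k \<in> {1..r}"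
  shows "node_poly r b (add_unit n k) = [:-b k, 1:] * node_poly r b n"
proof -
  have "(\<Prod>j\<in>{1..r} - {k}. [:-b j, 1:] ^ add_unit n k j) = (\<Prod>j\<in>{1..r} - {k}. [:-b j, 1:] ^ n j)"
    by (intro prod.cong) (auto simp: add_unit_def)
  then show ?thesis
    unfolding node_poly_remove[OF assms] by (simp add: add_unit_def mult.assoc del: mult_pCons_left)
qed

lemma add_unit_drop_unit: "n k > 0 \<Longrightarrow> add_unit (drop_unit n k) k = n"
  by (auto simp: add_unit_def drop_unit_def)

lemma pderiv_node_poly:
  "pderiv (node_poly r b n) = (\<Sum>j=1..r. smult (real (n j)) (node_poly r b (drop_unit n j)))"
proof -
  have "(\<Prod>i\<in>{1..r} - {j}. [:-b i, 1:] ^ n i) * pderiv ([:-b j, 1:] ^ n j) =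
      smult (real (n j)) (node_poly r b (drop_unit n j))" if "j \<in> {1..r}" for j
  proof -
    have "(\<Prod>i\<in>{1..r} - {j}. [:-b i, 1:] ^ drop_unit n j i) = (\<Prod>i\<in>{1..r} - {j}. [:-b i, 1:] ^ n i)"
      by (intro prod.cong) (auto simp: drop_unit_def)
    then show ?thesis
      unfolding node_poly_remove[OF that]
      by (simp add: drop_unit_def pderiv_power pderiv_pCons mult.commute)
  qed
  then show ?thesis
    unfolding node_poly_def[of r b n] pderiv_prod by (intro sum.cong) auto
qed

text \<open>The image under \<^const>\<open>umbral\<close> of the product rule for \<open>s (p + p')\<close>, with \<open>s\<close> written as
  \<open>(s - b\<^sub>j) + b\<^sub>j\<close> in the \<open>j\<close>-th summand of \<open>s p'\<close>, and as \<open>(s - b\<^sub>k) + b\<^sub>k\<close> in \<open>s p\<close>.\<close>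

lemma charlier_recurrence:
  assumes k: "k \<in> {1..r}"
  shows "pCons 0 (charlier r b n) = charlier r b (add_unit n k) +
    smult (b k + real (\<Sum>j=1..r. n j)) (charlier r b n) +
    (\<Sum>j=1..r. smult (real (n j) * b j) (charlier r b (drop_unit n j)))"
proof -
  let ?p = "node_poly r b n" and ?q = "\<lambda>j. node_poly r b (drop_unit n j)"
  have "pCons 0 (smult (real (n j)) (?q j)) = smult (real (n j)) ?p + smult (real (n j) * b j) (?q j)"
    if "j \<in> {1..r}" for j
  proof (cases "n j = 0")
    case False
    then have "?p = [:-b j, 1:] * ?q j"
      using node_poly_add_unit[OF that, of b "drop_unit n j"] by (simp add: add_unit_drop_unit)
    then have "pCons 0 (?q j) = ?p + smult (b j) (?q j)" by simp
    then have "smult (real (n j)) (pCons 0 (?q j)) = smult (real (n j)) (?p + smult (b j) (?q j))"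
      by simp
    then show ?thesis by (simp add: smult_add_right)
  qed simp
  then have "(\<Sum>j=1..r. pCons 0 (smult (real (n j)) (?q j))) =
      (\<Sum>j=1..r. smult (real (n j)) ?p + smult (real (n j) * b j) (?q j))"
    by (intro sum.cong) auto
  moreover have "pCons 0 (pderiv ?p) = (\<Sum>j=1..r. pCons 0 (smult (real (n j)) (?q j)))"
    using sum_distrib_left[of "[:0, 1:]" "\<lambda>j. smult (real (n j)) (?q j)" "{1..r}"]
    by (simp add: pderiv_node_poly)
  moreover have "pCons 0 ?p = node_poly r b (add_unit n k) + smult (b k) ?p"
    by (simp add: node_poly_add_unit[OF k])
  moreover have "mult_X_dual ?p = pCons 0 ?p + pCons 0 (pderiv ?p)"
    by (simp add: mult_X_dual_def)
  ultimately have "mult_X_dual ?p = node_poly r b (add_unit n k) +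
      smult (b k + real (\<Sum>j=1..r. n j)) ?p + (\<Sum>j=1..r. smult (real (n j) * b j) (?q j))"
    by (simp add: sum.distrib smult_sum smult_add_left)
  from arg_cong[OF this, of umbral] show ?thesis
    by (simp add: charlier_def umbral_mult_X_dual umbral_add umbral_smult umbral_sum)
qed

section \<open>Quotients of neighbouring polynomials\<close>

lemma cpoly_pCons [simp]: "cpoly (pCons a p) z = of_real a + z * cpoly p z"
  by (simp add: cpoly_def map_poly_pCons)

lemma cpoly_0 [simp]: "cpoly 0 z = 0"
  by (simp add: cpoly_def)

lemma cpoly_add: "cpoly (p + q) z = cpoly p z + cpoly q z"
  by (induction p q rule: poly_induct2) (simp_all add: algebra_simps)

lemma cpoly_smult: "cpoly (smult c p) z = of_real c * cpoly p z"
  by (induction p) (simp_all add: algebra_simps)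

lemma cpoly_sum: "cpoly (sum f A) z = (\<Sum>i\<in>A. cpoly (f i) z)"
  by (induction A rule: infinite_finite_induct) (simp_all add: cpoly_add)

definition charlier_quot ::
  "nat \<Rightarrow> (nat \<Rightarrow> real) \<Rightarrow> (nat \<Rightarrow> nat) \<Rightarrow> nat \<Rightarrow> complex \<Rightarrow> complex" where
  "charlier_quot r b n k z = cpoly (charlier r b (add_unit n k)) z / cpoly (charlier r b n) z"

lemma charlier_quot_recurrence:
  assumes k: "k \<in> {1..r}" and nz: "cpoly (charlier r b n) z \<noteq> 0"
  shows "charlier_quot r b n k z = z - of_real (b k + real (\<Sum>j=1..r. n j)) -
    (\<Sum>j=1..r. of_real (real (n j) * b j) / charlier_quot r b (drop_unit n j) j z)"
proof -
  let ?C = "\<lambda>n. cpoly (charlier r b n) z"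
  have quot: "of_real (real (n j) * b j) * ?C (drop_unit n j) / ?C n =
      of_real (real (n j) * b j) / charlier_quot r b (drop_unit n j) j z" for j
    by (cases "n j = 0") (simp_all add: charlier_quot_def add_unit_drop_unit)
  have "z * ?C n = ?C (add_unit n k) + of_real (b k + real (\<Sum>j=1..r. n j)) * ?C n +
      (\<Sum>j=1..r. of_real (real (n j) * b j) * ?C (drop_unit n j))"
    using arg_cong[OF charlier_recurrence[OF k, of b n], of "\<lambda>p. cpoly p z"]
    by (simp only: cpoly_pCons cpoly_add cpoly_smult cpoly_sum of_real_0 add_0)
  then have "?C (add_unit n k) / ?C n = z - of_real (b k + real (\<Sum>j=1..r. n j)) -
      (\<Sum>j=1..r. of_real (real (n j) * b j) * ?C (drop_unit n j)) / ?C n"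
    using nz by (simp add: field_simps)
  then show ?thesis
    by (simp only: sum_divide_distrib quot charlier_quot_def[of r b n k])
qed

lemma charlier_empty_index:
  assumes "(\<Sum>j=1..r. n j) = 0"
  shows "charlier r b n = 1"
proof -
  have "node_poly r b n = 1"
    unfolding node_poly_def using assms by (intro prod.neutral) auto
  then show ?thesis by (simp add: charlier_def one_pCons)
qed

text \<open>A family of regions \<open>B k\<close> that is stable under the right-hand side of the quotient recurrence and
  avoids \<open>0\<close> contains all quotients. Avoiding \<open>0\<close> is what carries the induction: it makes the next
  polynomial nonzero, and so the next quotients meaningful.\<close>

lemma charlier_quot_invariant:
  assumes zero: "\<And>k. k \<in> {1..r} \<Longrightarrow> 0 \<notin> B k"
    and step: "\<And>k n w. \<lbrakk>k \<in> {1..r}; \<And>j. j \<in> {1..r} \<Longrightarrow> n j > 0 \<Longrightarrow> w j \<in> B j\<rbrakk> \<Longrightarrow>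
      z - of_real (b k + real (\<Sum>j=1..r. n j)) - (\<Sum>j=1..r. of_real (real (n j) * b j) / w j) \<in> B k"
  shows "cpoly (charlier r b n) z \<noteq> 0 \<and> (\<forall>k\<in>{1..r}. charlier_quot r b n k z \<in> B k)"
proof (induction "\<Sum>j=1..r. n j" arbitrary: n rule: less_induct)
  case less
  have IH: "cpoly (charlier r b (drop_unit n j)) z \<noteq> 0 \<and> charlier_quot r b (drop_unit n j) j z \<in> B j"
    if j: "j \<in> {1..r}" "n j > 0" for j
  proof -
    have "(\<Sum>i=1..r. drop_unit n j i) < (\<Sum>i=1..r. n i)"
      using j by (intro sum_strict_mono_ex1) (auto simp: drop_unit_def)
    from less[OF this] j show ?thesis by blast
  qed
  have nz: "cpoly (charlier r b n) z \<noteq> 0"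
  proof (cases "(\<Sum>j=1..r. n j) = 0")
    case True
    then show ?thesis by (simp add: charlier_empty_index one_pCons)
  next
    case False
    then obtain j where j: "j \<in> {1..r}" "n j > 0" by auto
    then show ?thesis
      using IH[OF j] zero[OF j(1)] by (auto simp: charlier_quot_def add_unit_drop_unit)
  qed
  have "charlier_quot r b n k z \<in> B k" if "k \<in> {1..r}" for k
    unfolding charlier_quot_recurrence[OF that nz] using that IH by (intro step) auto
  then show ?case using nz by blast
qed

text \<open>If all earlier quotients are in the half-plane of \<open>z\<close>, their reciprocals are in the opposite one,
  and subtracting positive multiples of them only moves away from the real axis. The factor \<open>s\<close>
  treats the upper and the lower half-plane together.\<close>

lemma charlier_quot_Im:
  assumes pos: "\<forall>j\<in>{1..r}. b j > 0" and s: "s * Im z > 0"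
  shows "cpoly (charlier r b n) z \<noteq> 0 \<and>
    (\<forall>k\<in>{1..r}. s * Im z \<le> s * Im (charlier_quot r b n k z))"
proof -
  define B where "B = (\<lambda>k::nat. {w. s * Im z \<le> s * Im w})"
  have "cpoly (charlier r b n) z \<noteq> 0 \<and> (\<forall>k\<in>{1..r}. charlier_quot r b n k z \<in> B k)"
  proof (rule charlier_quot_invariant)
    fix k and n :: "nat \<Rightarrow> nat" and w :: "nat \<Rightarrow> complex"
    assume w: "\<And>j. j \<in> {1..r} \<Longrightarrow> n j > 0 \<Longrightarrow> w j \<in> B j"
    have "s * Im (of_real (real (n j) * b j) / w j) \<le> 0" if "j \<in> {1..r}" for j
    proof (cases "n j = 0")
      case False
      then have "s * Im (w j) \<ge> 0" using w[OF that] s by (simp add: B_def)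
      then have "real (n j) * b j * (s * Im (w j)) \<ge> 0" using pos[rule_format, OF that] by simp
      moreover have "s * Im (of_real (real (n j) * b j) / w j) =
          - (real (n j) * b j * (s * Im (w j)) / (norm (w j))\<^sup>2)"
        by (simp add: Im_divide cmod_power2)
      ultimately show ?thesis by simp
    qed simp
    then have "(\<Sum>j=1..r. s * Im (of_real (real (n j) * b j) / w j)) \<le> 0"
      by (intro sum_nonpos) auto
    then show "z - of_real (b k + real (\<Sum>j=1..r. n j)) -
        (\<Sum>j=1..r. of_real (real (n j) * b j) / w j) \<in> B k"
      by (simp add: B_def right_diff_distrib sum_distrib_left del: of_real_mult)
  qed (use s in \<open>auto simp: B_def\<close>)
  then show ?thesis by (simp add: B_def)
qed

text \<open>Here \<open>|F\<^sub>j| \<ge> b\<^sub>j\<close> for the earlier quotients, so that the sum \<open>\<Sum>\<^sub>j n\<^sub>j b\<^sub>j / F\<^sub>j\<close> has modulus at most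
  \<open>|n|\<close>. The real part of \<open>- |n| - \<Sum>\<^sub>j n\<^sub>j b\<^sub>j / F\<^sub>j\<close> is therefore not positive, which leaves \<open>Re z - b\<^sub>k\<close>.\<close>

lemma charlier_quot_Re:
  assumes pos: "\<forall>j\<in>{1..r}. b j > 0" and z: "Re z \<le> 0"
  shows "cpoly (charlier r b n) z \<noteq> 0 \<and>
    (\<forall>k\<in>{1..r}. Re (charlier_quot r b n k z) \<le> Re z - b k)"
proof -
  define B where "B = (\<lambda>k::nat. {w. Re w \<le> Re z - b k})"
  have "cpoly (charlier r b n) z \<noteq> 0 \<and> (\<forall>k\<in>{1..r}. charlier_quot r b n k z \<in> B k)"
  proof (rule charlier_quot_invariant)
    fix k and n :: "nat \<Rightarrow> nat" and w :: "nat \<Rightarrow> complex"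
    assume w: "\<And>j. j \<in> {1..r} \<Longrightarrow> n j > 0 \<Longrightarrow> w j \<in> B j"
    have "- real (n j) \<le> Re (of_real (real (n j) * b j) / w j)" if j: "j \<in> {1..r}" for j
    proof (cases "n j = 0")
      case False
      have "b j > 0" using pos[rule_format, OF j] .
      moreover have "Re (w j) \<le> - b j" using w[OF j] False z by (simp add: B_def)
      then have "b j \<le> norm (w j)" using abs_Re_le_cmod[of "w j"] by linarith
      ultimately have "norm (of_real (real (n j) * b j) / w j) \<le> real (n j)"
        by (simp add: norm_divide norm_mult divide_le_eq mult_left_mono)
      then show ?thesis using abs_Re_le_cmod[of "of_real (real (n j) * b j) / w j"] by linarith
    qed simp
    then have "(\<Sum>j=1..r. - real (n j)) \<le> (\<Sum>j=1..r. Re (of_real (real (n j) * b j) / w j))"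
      by (intro sum_mono) auto
    then show "z - of_real (b k + real (\<Sum>j=1..r. n j)) -
        (\<Sum>j=1..r. of_real (real (n j) * b j) / w j) \<in> B k"
      by (simp add: B_def sum_negf del: of_real_mult)
  qed (use pos z in \<open>force simp: B_def\<close>)
  then show ?thesis by (simp add: B_def)
qed

section \<open>The limit function\<close>

text \<open>The value \<open>g\<close> solves \<open>g + c / g = x - m\<close>; the branch of the root selects the solution of larger
  modulus, see \<open>joukowski_inverse_dominant\<close> below.\<close>

definition joukowski_inverse :: "real \<Rightarrow> real \<Rightarrow> complex \<Rightarrow> complex" where
  "joukowski_inverse m c x = (x - of_real m + sqrt_branch m c x) / 2"

lemma joukowski_inverse_root:
  assumes "c > 0" "x \<in> - branch_cut m c"
  shows "joukowski_inverse m c x * (x - of_real m - joukowski_inverse m c x) = of_real c"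
proof -
  have "sqrt_branch m c x ^ 2 = (x - of_real m) ^ 2 - 4 * of_real c"
    using is_sqrt_branch_sqrt_branch[OF assms(1), of m] assms(2) by (simp add: is_sqrt_branch_def)
  then show ?thesis
    by (simp add: joukowski_inverse_def field_simps power2_eq_square)
qed

lemma continuous_on_joukowski_inverse:
  assumes "c > 0"
  shows "continuous_on (- branch_cut m c) (joukowski_inverse m c)"
proof -
  have "continuous_on (- branch_cut m c) (sqrt_branch m c)"
    using is_sqrt_branch_sqrt_branch[OF assms, of m] unfolding is_sqrt_branch_def
    by (intro holomorphic_on_imp_continuous_on analytic_imp_holomorphic) auto
  then show ?thesis
    unfolding joukowski_inverse_def by (intro continuous_intros) auto
qed

lemma bounded_branch_cut: "bounded (branch_cut m c)"
  unfolding branch_cut_def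
  by (intro compact_imp_bounded compact_continuous_image continuous_intros) auto

lemma connected_Compl_branch_cut: "connected (- branch_cut m c)"
proof -
  have "convex (branch_cut m c)"
    unfolding branch_cut_def by (intro convex_linear_image) (auto simp: linear_iff scaleR_conv_of_real)
  then show ?thesis
    using connected_complement_bounded_convex[OF bounded_branch_cut] by (simp add: DIM_complex)
qed

text \<open>If the two roots \<open>g\<close> and \<open>c / g\<close> have equal modulus, they are complex conjugate and \<open>x\<close> is on the
  cut. So \<open>|g|\<^sup>2 - c\<close> has no zero on the complement of the cut; this set is connected and the
  difference is positive near infinity.\<close>

lemma joukowski_inverse_dominant:
  assumes c: "c > 0" and x: "x \<in> - branch_cut m c"
  shows "c < (norm (joukowski_inverse m c x))\<^sup>2"
proof -
  let ?D = "- branch_cut m c" and ?g = "joukowski_inverse m c"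
  define f where "f = (\<lambda>y. (norm (?g y))\<^sup>2)"
  have off: "f y \<noteq> c" if y: "y \<in> ?D" for y
  proof
    assume "f y = c"
    then have gc: "?g y * cnj (?g y) = of_real c"
      by (simp add: f_def complex_norm_square [symmetric] flip: of_real_power)
    have nz: "?g y \<noteq> 0" using \<open>f y = c\<close> c by (auto simp: f_def)
    have "?g y * (y - of_real m - ?g y) = ?g y * cnj (?g y)"
      by (rule trans[OF joukowski_inverse_root[OF c y] gc[symmetric]])
    then have "y - of_real m - ?g y = cnj (?g y)"
      by (rule mult_left_cancel[OF nz, THEN iffD1])
    then have "y - of_real m = ?g y + cnj (?g y)" by (simp add: algebra_simps)
    then have "y - of_real m = of_real (2 * Re (?g y))" by (simp only: complex_add_cnj)
    then have "(y - of_real m) ^ 2 = of_real (4 * (Re (?g y))\<^sup>2)" by (simp add: power_mult_distrib)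
    moreover have "(Re (?g y))\<^sup>2 \<le> c"
      using \<open>f y = c\<close> cmod_power2[of "?g y"] zero_le_power2[of "Im (?g y)"] by (simp only: f_def)
    ultimately have "y \<in> branch_cut m c" 
      by (intro mem_branch_cutI[OF c, of y m "4 * (Re (?g y))\<^sup>2"]) auto
    then show False using y by simp
  qed
  have "((\<lambda>y. 1 - of_real m * inverse y + sqrt_branch m c y / y) \<longlongrightarrow> 1 - of_real m * 0 + 1) at_infinity"
    using is_sqrt_branch_sqrt_branch[OF c, of m] unfolding is_sqrt_branch_def
    by (intro tendsto_intros tendsto_inverse_0) auto
  from tendsto_norm[OF this] have "((\<lambda>y. norm (1 - of_real m * inverse y + sqrt_branch m c y / y)) \<longlongrightarrow> 2) at_infinity"
    by simp
  then have "\<forall>\<^sub>F y in at_infinity. 1 < norm (1 - of_real m * inverse y + sqrt_branch m c y / y)"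
    by (rule order_tendstoD) simp
  moreover obtain B where B: "\<And>y. y \<in> branch_cut m c \<Longrightarrow> norm y \<le> B"
    using bounded_branch_cut unfolding bounded_iff by blast
  have "\<forall>\<^sub>F y::complex in at_infinity. max B (2 * sqrt c) < norm y"
    unfolding eventually_at_infinity by (rule exI[of _ "max B (2 * sqrt c) + 1"]) auto
  ultimately have "\<forall>\<^sub>F y in at_infinity. y \<in> ?D \<and> c < f y"
  proof eventually_elim
    case (elim y)
    have "y \<noteq> 0" using elim(2) c by auto
    then have "?g y = y / 2 * (1 - of_real m * inverse y + sqrt_branch m c y / y)"
      by (simp add: joukowski_inverse_def field_simps)
    then have "norm (?g y) = norm y / 2 * norm (1 - of_real m * inverse y + sqrt_branch m c y / y)"
      by (simp only: norm_mult norm_divide norm_numeral)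
    then have "norm (?g y) \<ge> norm y / 2 * 1"
      using elim(1) mult_left_mono[of 1 _ "norm y / 2"] by simp
    then have "sqrt c < norm (?g y)" using elim(2) by simp
    then have "(sqrt c)\<^sup>2 < (norm (?g y))\<^sup>2" using c by (intro power_strict_mono) auto
    then have "c < f y" using c by (simp add: f_def)
    moreover have "y \<in> ?D" using B[of y] elim(2) by auto
    ultimately show ?case by simp
  qed
  then obtain y where y: "y \<in> ?D" "c < f y"
    using eventually_happens[of _ "at_infinity :: complex filter"] trivial_limit_at_infinity by blast
  have "continuous_on ?D f"
    unfolding f_def using continuous_on_joukowski_inverse[OF c] by (intro continuous_intros)
  then have "connected (f ` ?D)"
    using connected_Compl_branch_cut by (rule connected_continuous_image)
  then have "c \<in> f ` ?D" if "f x \<le> c"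
    using connected_iff_interval[THEN iffD1, rule_format, of "f ` ?D" "f x" "f y" c] that x y by auto
  then show ?thesis using off by (force simp: f_def)
qed

text \<open>Suppose both roots have modulus at least \<open>\<alpha>\<close>. Two numbers \<open>u, v \<ge> \<alpha>\<close> with product \<open>c\<close> satisfy
  \<open>u + v \<le> \<alpha> + c / \<alpha>\<close>, which is less than \<open>\<alpha> + \<tau>\<close>; but \<open>|x - (\<alpha> + \<tau>)| \<ge> \<alpha> + \<tau>\<close> when \<open>Re x \<le> 0\<close>.\<close>

lemma dominated_root_small:
  fixes g h x :: complex and \<alpha> \<tau> c :: real
  assumes pos: "\<alpha> > 0" "0 < c" "c < \<alpha> * \<tau>"
    and roots: "g * h = of_real c" "g + h = x - of_real (\<alpha> + \<tau>)"
    and dom: "c < (norm g)\<^sup>2" and x: "Re x \<le> 0"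
  shows "norm h < \<alpha>"
proof (rule ccontr)
  define u v where "u = norm h" and "v = norm g"
  assume "\<not> norm h < \<alpha>"
  then have u: "u \<ge> \<alpha>" by (simp add: u_def)
  have uv: "v * u = c" using arg_cong[OF roots(1), of norm] pos by (simp add: u_def v_def norm_mult)
  have "u < v"
  proof (rule ccontr)
    assume "\<not> u < v"
    then have "v * v \<le> v * u" by (intro mult_left_mono) (auto simp: v_def)
    then show False using uv dom by (simp add: v_def power2_eq_square)
  qed
  then have "v \<ge> \<alpha>" using u by simp
  then have "(u - \<alpha>) * (v - \<alpha>) \<ge> 0" using u by simp
  then have "\<alpha> * (u + v) \<le> c + \<alpha> * \<alpha>" using uv by (simp add: algebra_simps)
  also have "\<dots> < \<alpha> * (\<alpha> + \<tau>)" using pos by (simp add: algebra_simps)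
  finally have "u + v < \<alpha> + \<tau>" using pos by simp
  moreover have "norm (x - of_real (\<alpha> + \<tau>)) \<le> u + v"
    using norm_triangle_ineq[of g h] by (simp only: roots(2) u_def v_def add.commute)
  moreover have "\<alpha> + \<tau> \<le> norm (x - of_real (\<alpha> + \<tau>))"
    using abs_Re_le_cmod[of "x - of_real (\<alpha> + \<tau>)"] x by simp
  ultimately show False by linarith
qed

text \<open>With \<open>\<rho> = c / |g|\<^sup>2 < 1\<close> one has \<open>Im h = - \<rho> Im g\<close> and \<open>Im x = (1 - \<rho>) Im g\<close>: the smaller root lies
  in the half-plane opposite to \<open>x\<close>.\<close>

lemma dominated_root_Im:
  fixes g h x :: complex and m c s :: real
  assumes c: "0 < c" and roots: "g * h = of_real c" "g + h = x - of_real m"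
    and dom: "c < (norm g)\<^sup>2" and x: "s * Im x > 0"
  shows "s * Im h < 0"
proof -
  have "norm g > 0" using dom c by (auto intro: ccontr)
  then have g: "g \<noteq> 0" by auto
  define \<rho> where "\<rho> = c / (norm g)\<^sup>2"
  have rho: "0 < \<rho>" "\<rho> < 1" using c dom by (auto simp: \<rho>_def divide_simps)
  have h: "h = of_real c / g" using roots(1) g by (simp add: field_simps)
  have Im_h: "Im h = - \<rho> * Im g" by (simp add: h Im_divide cmod_power2 \<rho>_def)
  have "Im x = Im g + Im h" using arg_cong[OF roots(2), of Im] by simp
  then have "Im x = (1 - \<rho>) * Im g" by (simp add: Im_h algebra_simps)
  then have "s * Im x = (1 - \<rho>) * (s * Im g)" by (simp add: mult.left_commute)
  then have "0 < (1 - \<rho>) * (s * Im g)" using x by (simp only:)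
  then have "s * Im g > 0" using rho by (simp only: zero_less_mult_iff) auto
  then have "\<rho> * (s * Im g) > 0" using rho by simp
  then show ?thesis by (simp add: Im_h algebra_simps)
qed

text \<open>The map \<open>z' \<mapsto> g + h - g h / z'\<close> has the fixed points \<open>g\<close> and \<open>h\<close> and multiplies the cross-ratio
  coordinate \<open>(z - g) / (z - h)\<close> by \<open>h / g\<close>. The perturbation \<open>e\<close> changes this coordinate by
  \<open>e (g - h) / ((z - h) (z - e - h))\<close>, and \<open>|z - e - h| \<ge> d / 2\<close>.\<close>

lemma mobius_contraction:
  fixes g h z z' e :: complex and d :: real
  assumes z: "z = g + h - g * h / z' + e"
    and nz: "g \<noteq> 0" "z' \<noteq> 0" and d: "d > 0" "norm (z - h) \<ge> d" "norm (z' - h) \<ge> d"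
    and e: "norm e \<le> d / 2"
  shows "norm ((z - g) / (z - h)) \<le>
    norm (h / g) * norm ((z' - g) / (z' - h)) + 2 * norm (g - h) / d\<^sup>2 * norm e"
proof -
  define y where "y = z - e"
  have zh: "z - h \<noteq> 0" and z'h: "z' - h \<noteq> 0" using d by auto
  have yh_ge: "d / 2 \<le> norm (y - h)"
    using norm_triangle_ineq2[of "z - h" e] d e by (simp add: y_def algebra_simps)
  then have yh: "y - h \<noteq> 0" using d by auto
  have "y - g = h * (z' - g) / z'" "y - h = g * (z' - h) / z'"
    using nz by (simp_all add: y_def z field_simps)
  then have wy: "(y - g) / (y - h) = h / g * ((z' - g) / (z' - h))"
    using nz by simp
  have "(z - g) / (z - h) - (y - g) / (y - h) = e * (g - h) / ((z - h) * (y - h))"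
    using zh yh by (simp add: y_def diff_frac_eq) (simp add: algebra_simps)
  then have "norm ((z - g) / (z - h) - (y - g) / (y - h)) =
      norm e * norm (g - h) / (norm (z - h) * norm (y - h))"
    by (simp add: norm_divide norm_mult)
  also have "\<dots> \<le> norm e * norm (g - h) / (d * (d / 2))"
    using d yh_ge by (intro divide_left_mono mult_mono mult_pos_pos) (auto simp: yh zh)
  also have "\<dots> = 2 * norm (g - h) / d\<^sup>2 * norm e" by (simp add: power2_eq_square)
  finally have "norm ((z - g) / (z - h)) \<le> norm ((y - g) / (y - h)) + 2 * norm (g - h) / d\<^sup>2 * norm e"
    using norm_triangle_ineq2[of "(z - g) / (z - h)" "(y - g) / (y - h)"] by linarith
  then show ?thesis by (simp only: wy norm_mult)
qed

section \<open>Scaled quotients and their approximate recurrence\<close>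

definition scaled_quot ::
  "nat \<Rightarrow> (nat \<Rightarrow> real) \<Rightarrow> nat \<Rightarrow> (nat \<Rightarrow> nat) \<Rightarrow> nat \<Rightarrow> complex \<Rightarrow> complex" where
  "scaled_quot r a N n k x = charlier_quot r (scaled_params r a N) n k (of_nat N * x) / of_nat N"

text \<open>Positive exactly off the half-line \<open>[0, \<infinity>)\<close>; it bundles the bounds coming from the two
  half-planes and the left half-plane.\<close>

definition cut_dist :: "complex \<Rightarrow> real" where
  "cut_dist x = max \<bar>Im x\<bar> (- Re x)"

lemma cut_dist_pos: "x \<notin> complex_of_real ` {0..} \<Longrightarrow> cut_dist x > 0"
proof (rule ccontr)
  assume x: "x \<notin> complex_of_real ` {0..}" and "\<not> cut_dist x > 0"
  then have "Im x = 0" "Re x \<ge> 0" by (auto simp: cut_dist_def)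
  then have "x = complex_of_real (Re x)" by (simp add: complex_eq_iff)
  then show False using x \<open>Re x \<ge> 0\<close> by (metis atLeast_iff imageI)
qed

lemma scaled_params_pos:
  assumes "\<forall>j\<in>{1..r}. a j > 0" "N > 0"
  shows "\<forall>j\<in>{1..r}. scaled_params r a N j > 0"
  using assms by (simp add: scaled_params_def)

lemma scaled_quot_Im:
  assumes pos: "\<forall>j\<in>{1..r}. a j > 0" and N: "N > 0" and k: "k \<in> {1..r}" and s: "s * Im x > 0"
  shows "cpoly (charlier r (scaled_params r a N) n) (of_nat N * x) \<noteq> 0"
    and "s * Im x \<le> s * Im (scaled_quot r a N n k x)"
proof -
  have "real N * (s * Im x) > 0" using s N by simp
  then have "s * Im (of_nat N * x) > 0" by (simp add: mult.left_commute)
  from charlier_quot_Im[OF scaled_params_pos[OF pos N] this, where n = n]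
  have *: "cpoly (charlier r (scaled_params r a N) n) (of_nat N * x) \<noteq> 0"
    "s * Im (of_nat N * x) \<le> s * Im (charlier_quot r (scaled_params r a N) n k (of_nat N * x))"
    using k by auto
  show "cpoly (charlier r (scaled_params r a N) n) (of_nat N * x) \<noteq> 0" by (rule *)
  show "s * Im x \<le> s * Im (scaled_quot r a N n k x)"
    using *(2) N by (simp add: scaled_quot_def field_simps)
qed

lemma scaled_quot_Re:
  assumes pos: "\<forall>j\<in>{1..r}. a j > 0" and N: "N > 0" and k: "k \<in> {1..r}" and x: "Re x \<le> 0"
  shows "cpoly (charlier r (scaled_params r a N) n) (of_nat N * x) \<noteq> 0"
    and "Re (scaled_quot r a N n k x) \<le> Re x - scaled_params r a N k / real N"
proof -
  have "Re (of_nat N * x) \<le> 0" using x by (simp add: mult_nonneg_nonpos)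
  from charlier_quot_Re[OF scaled_params_pos[OF pos N] this, where n = n]
  have *: "cpoly (charlier r (scaled_params r a N) n) (of_nat N * x) \<noteq> 0"
    "Re (charlier_quot r (scaled_params r a N) n k (of_nat N * x)) \<le>
       Re (of_nat N * x) - scaled_params r a N k"
    using k by auto
  show "cpoly (charlier r (scaled_params r a N) n) (of_nat N * x) \<noteq> 0" by (rule *)
  show "Re (scaled_quot r a N n k x) \<le> Re x - scaled_params r a N k / real N"
    using *(2) N by (simp add: scaled_quot_def field_simps)
qed

lemma scaled_quot_lower_bound:
  assumes pos: "\<forall>j\<in>{1..r}. a j > 0" and N: "N > 0" and k: "k \<in> {1..r}" and x: "cut_dist x > 0"
  shows "cpoly (charlier r (scaled_params r a N) n) (of_nat N * x) \<noteq> 0"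
    and "cut_dist x \<le> norm (scaled_quot r a N n k x)"
proof -
  note Im = scaled_quot_Im[OF pos N k, where s = "sgn (Im x)" and x = x and n = n]
  note Re = scaled_quot_Re[OF pos N k, where x = x and n = n]
  have "sgn (Im x) * Im x > 0 \<or> Re x \<le> 0"
    using x by (auto simp: cut_dist_def sgn_if)
  then show "cpoly (charlier r (scaled_params r a N) n) (of_nat N * x) \<noteq> 0"
    using Im(1) Re(1) by blast
  let ?z = "scaled_quot r a N n k x"
  have "\<bar>Im x\<bar> \<le> norm ?z"
  proof (cases "Im x = 0")
    case False
    then have "sgn (Im x) * Im x > 0" by (simp add: sgn_if)
    from Im(2)[OF this] have "\<bar>Im x\<bar> \<le> \<bar>Im ?z\<bar>" by (auto simp: sgn_if split: if_splits)
    then show ?thesis using abs_Im_le_cmod[of ?z] by linarith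
  qed simp
  moreover have "- Re x \<le> norm ?z"
  proof (cases "Re x \<le> 0")
    case True
    have "scaled_params r a N k / real N \<ge> 0"
      using scaled_params_pos[OF pos N] k by (simp add: less_imp_le)
    then show ?thesis using Re(2)[OF True] abs_Re_le_cmod[of ?z] by linarith
  next
    case False
    then show ?thesis using norm_ge_zero[of ?z] by linarith
  qed
  ultimately show "cut_dist x \<le> norm ?z" by (simp add: cut_dist_def)
qed

lemma scaled_quot_recurrence:
  assumes N: "N > 0" and k: "k \<in> {1..r}"
    and nz: "cpoly (charlier r (scaled_params r a N) n) (of_nat N * x) \<noteq> 0"
  shows "scaled_quot r a N n k x = x -
    of_real ((if k = r then a r else a k / real N) + real (\<Sum>j=1..r. n j) / real N) -
    of_real (real (n r) * a r / real N) / scaled_quot r a N (drop_unit n r) r x -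
    (\<Sum>j\<in>{1..<r}. of_real (real (n j) * a j / (real N)\<^sup>2) / scaled_quot r a N (drop_unit n j) j x)"
proof -
  let ?b = "scaled_params r a N"
  let ?F = "\<lambda>j. charlier_quot r ?b (drop_unit n j) j (of_nat N * x)"
  have r: "r \<in> {1..r}" "{1..r} = insert r {1..<r}" using k by auto
  have "charlier_quot r ?b n k (of_nat N * x) = of_nat N * x -
      of_real (?b k + real (\<Sum>j=1..r. n j)) - (\<Sum>j=1..r. of_real (real (n j) * ?b j) / ?F j)"
    by (rule charlier_quot_recurrence[OF k nz])
  also have "(\<Sum>j=1..r. of_real (real (n j) * ?b j) / ?F j) =
      of_real (real (n r) * (real N * a r)) / ?F r +
      (\<Sum>j\<in>{1..<r}. of_real (real (n j) * a j) / ?F j)"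
    unfolding r(2) by (subst sum.insert) (auto simp: scaled_params_def intro!: sum.cong)
  finally have "scaled_quot r a N n k x = (of_nat N * x -
      of_real (?b k + real (\<Sum>j=1..r. n j)) - (of_real (real (n r) * (real N * a r)) / ?F r +
      (\<Sum>j\<in>{1..<r}. of_real (real (n j) * a j) / ?F j))) / of_nat N"
    unfolding scaled_quot_def by (rule arg_cong)
  also have "\<dots> = of_nat N * x / of_nat N - of_real (?b k + real (\<Sum>j=1..r. n j)) / of_nat N -
      of_real (real (n r) * (real N * a r)) / ?F r / of_nat N -
      (\<Sum>j\<in>{1..<r}. of_real (real (n j) * a j) / ?F j / of_nat N)"
    by (simp only: diff_divide_distrib add_divide_distrib sum_divide_distrib diff_diff_eq add.assoc)
  also have "of_nat N * x / of_nat N = x" using N by simp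
  also have "of_real (?b k + real (\<Sum>j=1..r. n j)) / (of_nat N :: complex) =
      of_real ((if k = r then a r else a k / real N) + real (\<Sum>j=1..r. n j) / real N)"
    using N by (simp add: scaled_params_def add_divide_distrib)
  also have "of_real (real (n r) * (real N * a r)) / ?F r / of_nat N =
      of_real (real (n r) * a r / real N) / scaled_quot r a N (drop_unit n r) r x"
    using N by (simp add: scaled_quot_def)
  also have "(\<Sum>j\<in>{1..<r}. of_real (real (n j) * a j) / ?F j / of_nat N) =
      (\<Sum>j\<in>{1..<r}. of_real (real (n j) * a j / (real N)\<^sup>2) / scaled_quot r a N (drop_unit n j) j x)"
    using N by (intro sum.cong) (auto simp: scaled_quot_def power2_eq_square)
  finally show ?thesis .
qed

text \<open>An upper bound, independent of \<open>x\<close>, for the error made when the exact recurrence is replaced by the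
  limiting one, for points with \<open>cut_dist x \<ge> d\<close>. The last summand absorbs all terms with \<open>j < r\<close>.\<close>

definition recurrence_defect ::
  "nat \<Rightarrow> (nat \<Rightarrow> real) \<Rightarrow> real \<Rightarrow> real \<Rightarrow> real \<Rightarrow> nat \<Rightarrow> nat \<Rightarrow> (nat \<Rightarrow> nat) \<Rightarrow> real" where
  "recurrence_defect r a c \<tau> d k N n =
     \<bar>(if k = r then 0 else a k) * inverse (real N)\<bar> + \<bar>real (\<Sum>j=1..r. n j) / real N - \<tau>\<bar> +
     \<bar>real (n r) / real N * a r - c\<bar> / d +
     real (\<Sum>j=1..r. n j) / real N * (\<Sum>j\<in>{1..<r}. a j) * inverse (real N) / d"

lemma scaled_quot_approx_recurrence:
  assumes pos: "\<forall>j\<in>{1..r}. a j > 0" and N: "N > 0" and k: "k \<in> {1..r}"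
    and d: "d > 0" "d \<le> cut_dist x"
  shows "norm (scaled_quot r a N n k x - (x - of_real ((if k = r then a r else 0) + \<tau>) -
      of_real c / scaled_quot r a N (drop_unit n r) r x)) \<le> recurrence_defect r a c \<tau> d k N n"
proof -
  let ?A = "\<lambda>j. scaled_quot r a N (drop_unit n j) j x"
  let ?S = "real (\<Sum>j=1..r. n j)"
  have r: "r \<in> {1..r}" using k by auto
  have A: "d \<le> norm (?A j)" if "j \<in> {1..r}" for j
    using scaled_quot_lower_bound(2)[OF pos N that, where x = x and n = "drop_unit n j"] d by linarith
  have quot: "norm (of_real y / ?A j) \<le> \<bar>y\<bar> / d" if "j \<in> {1..r}" for y j
    using A[OF that] d(1) by (simp add: norm_divide frac_le)
  have nz: "cpoly (charlier r (scaled_params r a N) n) (of_nat N * x) \<noteq> 0"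
    using d by (intro scaled_quot_lower_bound(1)[OF pos N k]) auto
  have small: "norm (\<Sum>j\<in>{1..<r}. of_real (real (n j) * a j / (real N)\<^sup>2) / ?A j) \<le>
      ?S / real N * (\<Sum>j\<in>{1..<r}. a j) / real N / d"
  proof -
    have "norm (of_real (real (n j) * a j / (real N)\<^sup>2) / ?A j) \<le> ?S / real N * a j / real N / d"
      if j: "j \<in> {1..<r}" for j
    proof -
      have j': "j \<in> {1..r}" using j by auto
      have "n j \<le> (\<Sum>j=1..r. n j)" using j' by (intro member_le_sum) auto
      then have "real (n j) \<le> ?S" by (rule of_nat_mono)
      then have "real (n j) * a j / (real N)\<^sup>2 \<le> ?S * a j / (real N)\<^sup>2"
        using pos[rule_format, OF j'] by (intro divide_right_mono mult_right_mono) auto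
      also have "\<dots> = ?S / real N * a j / real N" by (simp add: power2_eq_square)
      finally have "real (n j) * a j / (real N)\<^sup>2 / d \<le> ?S / real N * a j / real N / d"
        using d by (intro divide_right_mono) auto
      moreover have "\<bar>real (n j) * a j / (real N)\<^sup>2\<bar> = real (n j) * a j / (real N)\<^sup>2"
        using pos[rule_format, OF j'] by simp
      ultimately show ?thesis
        using quot[OF j', of "real (n j) * a j / (real N)\<^sup>2"] by (simp only:) (rule order_trans)
    qed
    then have "norm (\<Sum>j\<in>{1..<r}. of_real (real (n j) * a j / (real N)\<^sup>2) / ?A j) \<le>
        (\<Sum>j\<in>{1..<r}. ?S / real N * a j / real N / d)"
      by (intro sum_norm_le)
    also have "\<dots> = ?S / real N * (\<Sum>j\<in>{1..<r}. a j) / real N / d"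
      by (simp only: sum_distrib_left sum_divide_distrib)
    finally show "norm (\<Sum>j\<in>{1..<r}. of_real (real (n j) * a j / (real N)\<^sup>2) / ?A j) \<le>
        ?S / real N * (\<Sum>j\<in>{1..<r}. a j) / real N / d" .
  qed
  have norm4: "norm (- p - q - u - v) \<le> norm p + norm q + norm u + norm v" for p q u v :: complex
    using norm_triangle_ineq4[of "- p - q - u" v] norm_triangle_ineq4[of "- p - q" u]
      norm_triangle_ineq4[of "- p" q] norm_minus_cancel[of p] by linarith
  have "scaled_quot r a N n k x - (x - of_real ((if k = r then a r else 0) + \<tau>) - of_real c / ?A r) =
      - of_real (if k = r then 0 else a k / real N) - of_real (?S / real N - \<tau>) -
      of_real (real (n r) * a r / real N - c) / ?A r -
      (\<Sum>j\<in>{1..<r}. of_real (real (n j) * a j / (real N)\<^sup>2) / ?A j)"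
  proof -
    let ?s = "?S / real N" and ?y = "real (n r) * a r / real N"
    have shift: "complex_of_real ((if k = r then a r else a k / real N) + ?s) =
        of_real ((if k = r then a r else 0) + \<tau>) + of_real (if k = r then 0 else a k / real N) +
        of_real (?s - \<tau>)"
      by (simp only: of_real_add [symmetric] of_real_eq_iff split: if_split) simp
    have quot_split: "complex_of_real ?y / ?A r = of_real c / ?A r + of_real (?y - c) / ?A r"
      by (simp only: add_divide_distrib [symmetric] of_real_add [symmetric]) simp
    show ?thesis
      unfolding scaled_quot_recurrence[OF N k nz] shift quot_split by (simp only: diff_diff_eq) algebra
  qed
  then have "norm (scaled_quot r a N n k x -
      (x - of_real ((if k = r then a r else 0) + \<tau>) - of_real c / ?A r)) \<le>
      norm (of_real (if k = r then 0 else a k / real N) :: complex) +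
      norm (of_real (?S / real N - \<tau>) :: complex) +
      norm (of_real (real (n r) * a r / real N - c) / ?A r) +
      norm (\<Sum>j\<in>{1..<r}. of_real (real (n j) * a j / (real N)\<^sup>2) / ?A j)"
    using norm4 by (simp only:)
  also have "\<dots> \<le> \<bar>(if k = r then 0 else a k / real N)\<bar> + \<bar>?S / real N - \<tau>\<bar> +
      \<bar>real (n r) * a r / real N - c\<bar> / d + ?S / real N * (\<Sum>j\<in>{1..<r}. a j) / real N / d"
    by (intro add_mono[OF add_mono[OF add_mono]] small quot[OF r]) (simp_all only: norm_of_real order_refl)
  also have "\<dots> = recurrence_defect r a c \<tau> d k N n"
    by (simp add: recurrence_defect_def divide_inverse mult_ac)
  finally show ?thesis .
qed

text \<open>The data of a multi-index that enter the limit. Passing from \<open>\<nu>\<close> to \<open>\<nu> - e\<^sub>r\<close> stays in this class,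
  which is what allows the recurrence to be iterated under the limit.\<close>

definition proportional_family ::
  "'i filter \<Rightarrow> ('i \<Rightarrow> nat) \<Rightarrow> ('i \<Rightarrow> nat \<Rightarrow> nat) \<Rightarrow> nat \<Rightarrow> real \<Rightarrow> real \<Rightarrow> bool" where
  "proportional_family F N \<nu> r \<rho> \<tau> \<longleftrightarrow>
     filterlim N sequentially F \<and>
     ((\<lambda>i. real (\<nu> i r) / real (N i)) \<longlongrightarrow> \<rho>) F \<and>
     ((\<lambda>i. real (\<Sum>j=1..r. \<nu> i j) / real (N i)) \<longlongrightarrow> \<tau>) F"

lemma proportional_family_inverse:
  assumes "proportional_family F N \<nu> r \<rho> \<tau>"
  shows "((\<lambda>i. inverse (real (N i))) \<longlongrightarrow> 0) F"
  using assms filterlim_compose[OF lim_inverse_n, of N F] by (simp add: proportional_family_def)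

lemma proportional_family_pos:
  assumes "proportional_family F N \<nu> r \<rho> \<tau>"
  shows "\<forall>\<^sub>F i in F. N i > 0"
  using assms eventually_compose_filterlim[OF eventually_gt_at_top, of N F 0] by (simp add: proportional_family_def)

lemma tendsto_quotient_perturb:
  assumes "((\<lambda>i. inverse (real (N i))) \<longlongrightarrow> 0) F" "((\<lambda>i. u i / real (N i)) \<longlongrightarrow> l) F"
    and "\<And>i. \<bar>v i - u i\<bar> \<le> 1"
  shows "((\<lambda>i. v i / real (N i)) \<longlongrightarrow> l) F"
proof -
  have "norm ((v i - u i) / real (N i)) \<le> inverse (real (N i))" for i
    using divide_right_mono[OF assms(3), of "real (N i)" i] by (simp add: abs_divide inverse_eq_divide)
  then have "((\<lambda>i. (v i - u i) / real (N i)) \<longlongrightarrow> 0) F"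
    by (intro Lim_null_comparison[OF _ assms(1)] always_eventually) auto
  from tendsto_add[OF this assms(2)] show ?thesis by (simp add: diff_divide_distrib)
qed

lemma proportional_family_drop:
  assumes fam: "proportional_family F N \<nu> r \<rho> \<tau>" and r: "r \<ge> 1"
  shows "proportional_family F N (\<lambda>i. drop_unit (\<nu> i) r) r \<rho> \<tau>"
  unfolding proportional_family_def
proof (intro conjI)
  note inv = proportional_family_inverse[OF fam]
  show "filterlim N sequentially F" using fam by (simp add: proportional_family_def)
  show "((\<lambda>i. real (drop_unit (\<nu> i) r r) / real (N i)) \<longlongrightarrow> \<rho>) F"
    by (rule tendsto_quotient_perturb[OF inv, of "\<lambda>i. real (\<nu> i r)"])
      (use fam in \<open>auto simp: proportional_family_def drop_unit_def\<close>)
  have "{1..r} = insert r {1..<r}" using r by auto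
  then have split: "(\<Sum>j=1..r. n j) = n r + (\<Sum>j\<in>{1..<r}. n j)" for n :: "nat \<Rightarrow> nat" by simp
  have "(\<Sum>j\<in>{1..<r}. drop_unit (\<nu> i) r j) = (\<Sum>j\<in>{1..<r}. \<nu> i j)" for i
    by (intro sum.cong) (auto simp: drop_unit_def)
  then have "\<bar>real (\<Sum>j=1..r. drop_unit (\<nu> i) r j) - real (\<Sum>j=1..r. \<nu> i j)\<bar> \<le> 1" for i
    unfolding split by (simp add: drop_unit_def)
  moreover have "((\<lambda>i. real (\<Sum>j=1..r. \<nu> i j) / real (N i)) \<longlongrightarrow> \<tau>) F"
    using fam by (simp add: proportional_family_def)
  ultimately show "((\<lambda>i. real (\<Sum>j=1..r. drop_unit (\<nu> i) r j) / real (N i)) \<longlongrightarrow> \<tau>) F"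
    by (rule tendsto_quotient_perturb[OF inv, rotated])
qed

lemma recurrence_defect_tendsto_0:
  assumes fam: "proportional_family F N \<nu> r \<rho> \<tau>" and d: "d \<noteq> 0"
  shows "((\<lambda>i. recurrence_defect r a (\<rho> * a r) \<tau> d k (N i) (\<nu> i)) \<longlongrightarrow> 0) F"
proof -
  note inv = proportional_family_inverse[OF fam]
  have \<rho>: "((\<lambda>i. real (\<nu> i r) / real (N i)) \<longlongrightarrow> \<rho>) F"
    and \<tau>: "((\<lambda>i. real (\<Sum>j=1..r. \<nu> i j) / real (N i)) \<longlongrightarrow> \<tau>) F"
    using fam by (simp_all only: proportional_family_def)
  have "((\<lambda>i. recurrence_defect r a (\<rho> * a r) \<tau> d k (N i) (\<nu> i)) \<longlongrightarrow>
      \<bar>(if k = r then 0 else a k) * 0\<bar> + \<bar>\<tau> - \<tau>\<bar> + \<bar>\<rho> * a r - \<rho> * a r\<bar> / d +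
      \<tau> * (\<Sum>j\<in>{1..<r}. a j) * 0 / d) F"
    unfolding recurrence_defect_def by (intro tendsto_intros inv \<rho> \<tau> d)
  then show ?thesis by simp
qed

section \<open>Convergence\<close>

text \<open>Off the real axis, the quotient and the repelling fixed point \<open>h\<close> are on different sides of it. For
  \<open>Re x \<le> 0\<close> the point \<open>h\<close> is inside the disc of radius \<open>a r\<close> and the quotient has real part at most
  \<open>Re x - a r\<close>.\<close>

lemma scaled_quot_separated:
  assumes pos: "\<forall>j\<in>{1..r}. a j > 0" and N: "N > 0" and r: "r \<ge> 1"
    and c: "0 < c" "c < a r * \<tau>"
    and roots: "g * h = of_real c" "g + h = x - of_real (a r + \<tau>)" and dom: "c < (norm g)\<^sup>2"
  shows "cut_dist x \<le> norm (scaled_quot r a N n r x - h)"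
proof -
  let ?z = "scaled_quot r a N n r x"
  have rr: "r \<in> {1..r}" using r by simp
  have "\<bar>Im x\<bar> \<le> norm (?z - h)"
  proof (cases "Im x = 0")
    case False
    then have s: "sgn (Im x) * Im x > 0" by (simp add: sgn_if)
    have "sgn (Im x) * Im h < 0" by (rule dominated_root_Im[OF c(1) roots dom s])
    moreover have "sgn (Im x) * Im x \<le> sgn (Im x) * Im ?z" by (rule scaled_quot_Im(2)[OF pos N rr s])
    ultimately have "\<bar>Im x\<bar> \<le> \<bar>Im (?z - h)\<bar>" using False by (auto simp: sgn_if split: if_splits)
    then show ?thesis using abs_Im_le_cmod[of "?z - h"] by linarith
  qed simp
  moreover have "- Re x \<le> norm (?z - h)"
  proof (cases "Re x \<le> 0")
    case True
    have "a r > 0" using pos rr by blast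
    then have "norm h < a r" using dominated_root_small[OF _ c roots dom True] by blast
    moreover have "Re ?z \<le> Re x - a r"
      using scaled_quot_Re(2)[OF pos N rr True, of n] N by (simp add: scaled_params_def)
    ultimately show ?thesis
      using abs_Re_le_cmod[of "?z - h"] abs_Re_le_cmod[of h] by simp
  next
    case False
    then show ?thesis using norm_ge_zero[of "?z - h"] by linarith
  qed
  ultimately show ?thesis by (simp add: cut_dist_def)
qed

text \<open>The left end of the cut is nonnegative because \<open>2 sqrt (\<alpha> \<tau>) \<le> \<alpha> + \<tau>\<close>.\<close>

lemma branch_cut_subset:
  assumes "0 < c" "c \<le> \<alpha> * \<tau>" "0 < \<alpha>" "0 < \<tau>"
  shows "branch_cut (\<alpha> + \<tau>) c \<subseteq> complex_of_real ` {0..}"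
proof -
  have "4 * c \<le> (\<alpha> + \<tau>)\<^sup>2"
    using assms(2) zero_le_power2[of "\<alpha> - \<tau>"] by (simp add: power2_eq_square algebra_simps)
  then have "sqrt (4 * c) \<le> \<alpha> + \<tau>" using assms by (intro real_le_lsqrt) auto
  then have "0 \<le> \<alpha> + \<tau> - 2 * sqrt c" by (simp add: real_sqrt_mult)
  then show ?thesis unfolding branch_cut_def by (intro image_mono) auto
qed

lemma compact_continuous_bounds:
  fixes K :: "complex set" and m c :: real
  assumes K: "compact K" "K \<subseteq> - complex_of_real ` {0..}" "K \<subseteq> - branch_cut m c" and c: "c > 0"
  obtains d k G where "d > 0" "0 \<le> k" "k < 1" "0 \<le> G"
    "\<And>x. x \<in> K \<Longrightarrow> d \<le> cut_dist x"
    "\<And>x. x \<in> K \<Longrightarrow> c / (norm (joukowski_inverse m c x))\<^sup>2 \<le> k"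
    "\<And>x. x \<in> K \<Longrightarrow> norm (joukowski_inverse m c x - (x - of_real m - joukowski_inverse m c x)) \<le> G"
proof (cases "K = {}")
  case True
  show ?thesis by (rule that[of 1 0 0]) (auto simp: True)
next
  case False
  let ?g = "joukowski_inverse m c"
  have g: "continuous_on K ?g"
    using continuous_on_joukowski_inverse[OF c] K(3) by (rule continuous_on_subset)
  have dom: "c < (norm (?g x))\<^sup>2" if "x \<in> K" for x
    using joukowski_inverse_dominant[OF c] K(3) that by blast
  have nz: "?g x \<noteq> 0" if "x \<in> K" for x using dom[OF that] c by auto
  have "continuous_on K cut_dist"
    unfolding cut_dist_def by (intro continuous_intros)
  then obtain x1 where x1: "x1 \<in> K" "\<And>x. x \<in> K \<Longrightarrow> cut_dist x1 \<le> cut_dist x"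
    using continuous_attains_inf[OF K(1) False] by blast
  have "continuous_on K (\<lambda>x. c / (norm (?g x))\<^sup>2)"
    using g nz by (intro continuous_intros) auto
  then obtain x2 where x2: "x2 \<in> K" "\<And>x. x \<in> K \<Longrightarrow> c / (norm (?g x))\<^sup>2 \<le> c / (norm (?g x2))\<^sup>2"
    using continuous_attains_sup[OF K(1) False] by blast
  have "continuous_on K (\<lambda>x. norm (?g x - (x - of_real m - ?g x)))"
    using g by (intro continuous_intros)
  then obtain x3 where x3: "x3 \<in> K"
      "\<And>x. x \<in> K \<Longrightarrow> norm (?g x - (x - of_real m - ?g x)) \<le> norm (?g x3 - (x3 - of_real m - ?g x3))"
    using continuous_attains_sup[OF K(1) False] by blast
  show ?thesis
  proof (rule that[of "cut_dist x1" "c / (norm (?g x2))\<^sup>2" "norm (?g x3 - (x3 - of_real m - ?g x3))"])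
    show "cut_dist x1 > 0" using x1(1) K(2) by (intro cut_dist_pos) auto
    show "c / (norm (?g x2))\<^sup>2 < 1" using dom[OF x2(1)] c by (simp add: divide_less_eq)
  qed (use c x1 x2 x3 in auto)
qed

text \<open>Let \<open>w\<close> be the cross-ratio coordinate of the quotient relative to \<open>g\<close> and \<open>h\<close>. It is bounded by
  \<open>1 + G / d\<close> for all indices, and \<open>L\<close> steps of the recurrence improve this to
  \<open>k ^ L (1 + G / d)\<close> plus an error that vanishes in the limit for each fixed \<open>L\<close>. The induction on \<open>L\<close>
  ranges over all families \<open>\<mu>\<close>, since its hypothesis is applied to \<open>\<mu> - e\<^sub>r\<close>.\<close>

lemma scaled_quot_tendsto:
  fixes F :: "'i filter"
  assumes pos: "\<forall>j\<in>{1..r}. a j > 0" and r: "r \<ge> 1"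
    and \<rho>: "0 < \<rho>" "\<rho> < \<tau>"
    and K: "compact K" "K \<subseteq> - complex_of_real ` {0..}"
    and fam: "proportional_family F N \<nu> r \<rho> \<tau>"
  shows "uniform_limit K (\<lambda>i. scaled_quot r a (N i) (\<nu> i) r)
    (joukowski_inverse (a r + \<tau>) (\<rho> * a r)) F"
proof -
  define m c where "m = a r + \<tau>" and "c = \<rho> * a r"
  define g where "g = joukowski_inverse m c"
  define h where "h = (\<lambda>x. x - of_real m - g x)"
  have rr: "r \<in> {1..r}" using r by simp
  have ar: "a r > 0" using pos rr by blast
  have c: "0 < c" "c < a r * \<tau>" using \<rho> ar by (auto simp: c_def mult.commute)
  have cut: "K \<subseteq> - branch_cut m c"
    using branch_cut_subset[of c "a r" \<tau>] K(2) c ar \<rho> unfolding m_def by auto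
  obtain d k G where d: "d > 0" "\<And>x. x \<in> K \<Longrightarrow> d \<le> cut_dist x"
    and k: "0 \<le> k" "k < 1" "\<And>x. x \<in> K \<Longrightarrow> c / (norm (g x))\<^sup>2 \<le> k"
    and G: "0 \<le> G" "\<And>x. x \<in> K \<Longrightarrow> norm (g x - h x) \<le> G"
    using compact_continuous_bounds[OF K cut c(1)] unfolding g_def h_def by metis
  have gh: "g x * h x = of_real c" "g x + h x = x - of_real (a r + \<tau>)" "c < (norm (g x))\<^sup>2"
    if "x \<in> K" for x
    using joukowski_inverse_root[OF c(1), of x m] joukowski_inverse_dominant[OF c(1), of x m] cut that
    by (auto simp: h_def g_def m_def)
  define w where "w = (\<lambda>N n x. (scaled_quot r a N n r x - g x) / (scaled_quot r a N n r x - h x))"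
  have sep: "d \<le> norm (scaled_quot r a N n r x - h x)" if "x \<in> K" "N > 0" for N n x
    using scaled_quot_separated[OF pos that(2) r c gh[OF that(1)], of n] d(2)[OF that(1)] by linarith

  have w_bound: "norm (w N n x) \<le> 1 + G / d" if x: "x \<in> K" and N: "N > 0" for N n x
  proof -
    let ?z = "scaled_quot r a N n r x"
    have "?z - h x \<noteq> 0" using sep[OF x N, of n] d by auto
    then have "w N n x = 1 - (g x - h x) / (?z - h x)" by (simp add: w_def field_simps)
    then have "norm (w N n x) \<le> 1 + norm (g x - h x) / norm (?z - h x)"
      using norm_triangle_ineq4[of 1 "(g x - h x) / (?z - h x)"] by (simp add: norm_divide)
    also have "norm (g x - h x) / norm (?z - h x) \<le> G / d"
      using G d(1) x sep[OF x N, of n] by (intro frac_le) auto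
    finally show ?thesis by simp
  qed
  have w_step: "norm (w N n x) \<le> k * norm (w N (drop_unit n r) x) +
      2 * G / d\<^sup>2 * recurrence_defect r a c \<tau> d r N n"
    if x: "x \<in> K" and N: "N > 0" and small: "recurrence_defect r a c \<tau> d r N n \<le> d / 2" for N n x
  proof -
    let ?z = "scaled_quot r a N n r x" and ?z' = "scaled_quot r a N (drop_unit n r) r x"
    define e where "e = ?z - (x - of_real (a r + \<tau>) - of_real c / ?z')"
    have e: "norm e \<le> recurrence_defect r a c \<tau> d r N n"
      using scaled_quot_approx_recurrence[OF pos N rr d(1) d(2)[OF x], of n \<tau> c] by (simp add: e_def)
    have nz: "g x \<noteq> 0" using gh(3)[OF x] c by auto
    have nz': "?z' \<noteq> 0"
      using scaled_quot_lower_bound(2)[OF pos N rr, of x "drop_unit n r"] d(1) d(2)[OF x] by auto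
    have "h x = of_real c / g x" using gh(1)[OF x] nz by (simp add: field_simps)
    then have hg: "norm (h x / g x) = c / (norm (g x))\<^sup>2"
      using c by (simp add: norm_divide norm_mult power2_eq_square)
    have z: "?z = g x + h x - g x * h x / ?z' + e" by (simp add: e_def gh[OF x])
    have "norm (w N n x) \<le> norm (h x / g x) * norm (w N (drop_unit n r) x) +
        2 * norm (g x - h x) / d\<^sup>2 * norm e"
      unfolding w_def
      by (rule mobius_contraction[OF z nz nz' d(1) sep[OF x N] sep[OF x N]]) (use e small in linarith)
    also have "\<dots> \<le> k * norm (w N (drop_unit n r) x) + 2 * G / d\<^sup>2 * recurrence_defect r a c \<tau> d r N n"
      using k(1) k(3)[OF x] G(1) G(2)[OF x] e d(1) unfolding hg
      by (intro add_mono mult_mono divide_right_mono) auto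
    finally show ?thesis .
  qed

  have iterate: "\<forall>\<^sub>F i in F. \<forall>x\<in>K. norm (w (N i) (\<mu> i) x) \<le> k ^ L * (1 + G / d) + \<epsilon>"
    if "proportional_family F N \<mu> r \<rho> \<tau>" "\<epsilon> > 0" for L \<mu> \<epsilon>
    using that
  proof (induction L arbitrary: \<mu> \<epsilon>)
    case 0
    show ?case using proportional_family_pos[OF fam]
    proof eventually_elim
      case (elim i)
      have "norm (w (N i) (\<mu> i) x) \<le> 1 + G / d + \<epsilon>" if "x \<in> K" for x
        using w_bound[OF that elim, of "\<mu> i"] \<open>\<epsilon> > 0\<close> by linarith
      then show ?case by simp
    qed
  next
    case (Suc L)
    let ?E = "\<lambda>i. recurrence_defect r a c \<tau> d r (N i) (\<mu> i)"
    have E: "(?E \<longlongrightarrow> 0) F"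
      unfolding c_def using d(1) by (intro recurrence_defect_tendsto_0[OF Suc.prems(1)]) auto
    have "((\<lambda>i. 2 * G / d\<^sup>2 * ?E i) \<longlongrightarrow> 2 * G / d\<^sup>2 * 0) F"
      by (intro tendsto_intros E)
    then have "\<forall>\<^sub>F i in F. 2 * G / d\<^sup>2 * ?E i < \<epsilon> / 2"
      by (rule order_tendstoD) (use Suc.prems(2) in simp)
    moreover have "\<forall>\<^sub>F i in F. ?E i < d / 2"
      by (rule order_tendstoD[OF E]) (use d(1) in simp)
    moreover have "\<forall>\<^sub>F i in F. \<forall>x\<in>K. norm (w (N i) (drop_unit (\<mu> i) r) x) \<le> k ^ L * (1 + G / d) + \<epsilon> / 2"
      using Suc.prems by (intro Suc.IH proportional_family_drop r) auto
    ultimately show ?case using proportional_family_pos[OF fam]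
    proof eventually_elim
      case (elim i)
      show ?case
      proof
        fix x assume x: "x \<in> K"
        have "norm (w (N i) (\<mu> i) x) \<le> k * norm (w (N i) (drop_unit (\<mu> i) r) x) + 2 * G / d\<^sup>2 * ?E i"
          using elim by (intro w_step x) auto
        also have "\<dots> \<le> k * (k ^ L * (1 + G / d) + \<epsilon> / 2) + \<epsilon> / 2"
          using elim x k(1) by (intro add_mono mult_left_mono) auto
        also have "\<dots> \<le> k ^ Suc L * (1 + G / d) + \<epsilon>"
        proof -
          have "k * (\<epsilon> / 2) \<le> 1 * (\<epsilon> / 2)"
            using k(2) Suc.prems(2) by (intro mult_right_mono) auto
          then show ?thesis by (simp only: power_Suc distrib_left mult.assoc)
        qed
        finally show "norm (w (N i) (\<mu> i) x) \<le> k ^ Suc L * (1 + G / d) + \<epsilon>" .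
      qed
    qed
  qed

  have "uniform_limit K (\<lambda>i. scaled_quot r a (N i) (\<nu> i) r) g F"
    unfolding uniform_limit_iff
  proof (intro allI impI)
    fix \<epsilon> :: real assume \<epsilon>: "\<epsilon> > 0"
    \<comment> \<open>If \<open>|w| \<le> \<eta> \<le> 1 / 2\<close>, solving \<open>z - g = w (z - h)\<close> for \<open>z - g\<close> gives \<open>|z - g| \<le> 2 \<eta> G\<close>.\<close>
    define \<eta> where "\<eta> = min (1 / 2) (\<epsilon> / (4 * (G + 1)))"
    have "\<epsilon> / (4 * (G + 1)) > 0" using \<epsilon> G(1) by simp
    then have \<eta>: "\<eta> > 0" "\<eta> \<le> 1 / 2" "\<eta> \<le> \<epsilon> / (4 * (G + 1))"
      unfolding \<eta>_def min_def by (simp_all only: split: if_split) simp_all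
    have "\<eta> * (4 * (G + 1)) \<le> \<epsilon>"
      using \<eta>(3) G(1) by (subst (asm) pos_le_divide_eq) auto
    moreover have "\<eta> * (4 * (G + 1)) = 2 * (2 * \<eta> * G) + 4 * \<eta>" by (simp add: algebra_simps)
    moreover have "2 * \<eta> * G \<ge> 0" using \<eta>(1) G(1) by simp
    ultimately have \<eta>G: "2 * \<eta> * G < \<epsilon>" using \<eta>(1) by linarith
    have "(\<lambda>L. k ^ L * (1 + G / d)) \<longlonglongrightarrow> 0 * (1 + G / d)"
      using k by (intro tendsto_intros LIMSEQ_realpow_zero) auto
    then have "\<forall>\<^sub>F L in sequentially. k ^ L * (1 + G / d) < \<eta> / 2"
      by (rule order_tendstoD) (use \<eta> in simp)
    then obtain L where L: "k ^ L * (1 + G / d) < \<eta> / 2"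
      by (auto simp: eventually_sequentially)
    have "\<forall>\<^sub>F i in F. \<forall>x\<in>K. norm (w (N i) (\<nu> i) x) \<le> k ^ L * (1 + G / d) + \<eta> / 2"
      using \<eta> by (intro iterate fam) auto
    with proportional_family_pos[OF fam]
    show "\<forall>\<^sub>F i in F. \<forall>x\<in>K. dist (scaled_quot r a (N i) (\<nu> i) r x) (g x) < \<epsilon>"
    proof eventually_elim
      case (elim i)
      show ?case
      proof
        fix x assume x: "x \<in> K"
        let ?z = "scaled_quot r a (N i) (\<nu> i) r x" and ?w = "w (N i) (\<nu> i) x"
        have "norm ?w \<le> k ^ L * (1 + G / d) + \<eta> / 2" using elim(2) x by blast
        then have w: "norm ?w \<le> \<eta>" using L by linarith
        have "?z - h x \<noteq> 0" using sep[OF x elim(1), of "\<nu> i"] d by auto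
        then have "?z - g x = ?w * ((?z - g x) + (g x - h x))" by (simp add: w_def)
        from arg_cong[OF this, of norm]
        have "norm (?z - g x) = norm ?w * norm ((?z - g x) + (g x - h x))"
          unfolding norm_mult .
        also have "\<dots> \<le> \<eta> * (norm (?z - g x) + G)"
          using w \<eta> norm_triangle_ineq[of "?z - g x" "g x - h x"] G(2)[OF x] by (intro mult_mono) auto
        also have "\<dots> \<le> 1 / 2 * norm (?z - g x) + \<eta> * G"
          using mult_right_mono[OF \<eta>(2), of "norm (?z - g x)"] by (simp add: algebra_simps)
        finally have "norm (?z - g x) \<le> 2 * \<eta> * G" by simp
        then show "dist ?z (g x) < \<epsilon>" using \<eta>G by (simp add: dist_norm)
      qed
    qed
  qed
  then show ?thesis by (simp add: g_def m_def c_def)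
qed

text \<open>For \<open>k \<noteq> r\<close> the recurrence expresses the quotient through \<open>A\<^sub>r(n - e\<^sub>r)\<close>, whose limit is known; the
  parameter \<open>a k / N\<close> disappears in the scaling, which is why \<open>a k\<close> is absent from the limit.\<close>

lemma scaled_quot_tendsto_other:
  fixes F :: "'i filter"
  assumes pos: "\<forall>j\<in>{1..r}. a j > 0" and k: "k \<in> {1..<r}"
    and \<rho>: "0 < \<rho>" "\<rho> < \<tau>"
    and K: "compact K" "K \<subseteq> - complex_of_real ` {0..}"
    and fam: "proportional_family F N \<nu> r \<rho> \<tau>"
  shows "uniform_limit K (\<lambda>i. scaled_quot r a (N i) (\<nu> i) k)
    (\<lambda>x. x - of_real \<tau> - of_real (\<rho> * a r) / joukowski_inverse (a r + \<tau>) (\<rho> * a r) x) F"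
proof -
  define m c where "m = a r + \<tau>" and "c = \<rho> * a r"
  define g where "g = joukowski_inverse m c"
  have r: "r \<ge> 1" and rr: "r \<in> {1..r}" and kk: "k \<in> {1..r}" "k \<noteq> r" using k by auto
  have ar: "a r > 0" using pos rr by blast
  have c: "0 < c" "c < a r * \<tau>" using \<rho> ar by (auto simp: c_def mult.commute)
  have cut: "K \<subseteq> - branch_cut m c"
    using branch_cut_subset[of c "a r" \<tau>] K(2) c ar \<rho> unfolding m_def by auto
  obtain d where d: "d > 0" "\<And>x. x \<in> K \<Longrightarrow> d \<le> cut_dist x"
    using compact_continuous_bounds[OF K cut c(1)] by metis
  have g: "sqrt c < norm (g x)" if "x \<in> K" for x
    using joukowski_inverse_dominant[OF c(1), of x m] cut that unfolding g_def
    by (intro real_less_lsqrt) auto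
  let ?E = "\<lambda>i. recurrence_defect r a c \<tau> d k (N i) (\<nu> i)"
  have E: "(?E \<longlongrightarrow> 0) F"
    unfolding c_def using d(1) by (intro recurrence_defect_tendsto_0[OF fam]) auto
  have lim: "uniform_limit K (\<lambda>i. scaled_quot r a (N i) (drop_unit (\<nu> i) r) r) g F"
    unfolding g_def m_def c_def
    by (rule scaled_quot_tendsto[OF pos r \<rho> K proportional_family_drop[OF fam r]])
  have "uniform_limit K (\<lambda>i. scaled_quot r a (N i) (\<nu> i) k) (\<lambda>x. x - of_real \<tau> - of_real c / g x) F"
    unfolding uniform_limit_iff
  proof (intro allI impI)
    fix \<epsilon> :: real assume \<epsilon>: "\<epsilon> > 0"
    \<comment> \<open>Chosen so that \<open>c |z - g| / (|z| |g|) \<le> \<epsilon> / 2\<close>, using \<open>|z| \<ge> d\<close> and \<open>|g| > sqrt c\<close>.\<close>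
    define \<eta> where "\<eta> = \<epsilon> / 2 * d * sqrt c / c"
    have \<eta>: "\<eta> > 0" using \<epsilon> d(1) c(1) by (simp add: \<eta>_def)
    have "\<forall>\<^sub>F i in F. ?E i < \<epsilon> / 2" by (rule order_tendstoD[OF E]) (use \<epsilon> in simp)
    moreover have "\<forall>\<^sub>F i in F. \<forall>x\<in>K. dist (scaled_quot r a (N i) (drop_unit (\<nu> i) r) r x) (g x) < \<eta>"
      using lim \<eta> unfolding uniform_limit_iff by blast
    ultimately show "\<forall>\<^sub>F i in F. \<forall>x\<in>K. dist (scaled_quot r a (N i) (\<nu> i) k x)
        (x - of_real \<tau> - of_real c / g x) < \<epsilon>"
      using proportional_family_pos[OF fam]
    proof eventually_elim
      case (elim i)
      show ?case
      proof
        fix x assume x: "x \<in> K"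
        let ?y = "scaled_quot r a (N i) (\<nu> i) k x" and ?z = "scaled_quot r a (N i) (drop_unit (\<nu> i) r) r x"
        have z: "d \<le> norm ?z"
          using scaled_quot_lower_bound(2)[OF pos elim(3) rr, of x "drop_unit (\<nu> i) r"] d(1) d(2)[OF x] by auto
        have nz: "?z \<noteq> 0" "g x \<noteq> 0" using z d(1) g[OF x] c(1) by auto
        have e: "norm (?y - (x - of_real \<tau> - of_real c / ?z)) < \<epsilon> / 2"
          using scaled_quot_approx_recurrence[OF pos elim(3) kk(1) d(1) d(2)[OF x], of "\<nu> i" \<tau> c]
            elim(1) kk(2) by simp
        have "of_real c / g x - of_real c / ?z = of_real c * (?z - g x) / (?z * g x)"
          using nz by (simp add: field_simps)
        then have "norm (of_real c / g x - of_real c / ?z) = c * norm (?z - g x) / (norm ?z * norm (g x))"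
          using c by (simp add: norm_divide norm_mult)
        also have "\<dots> \<le> c * \<eta> / (d * sqrt c)"
          using elim(2) x z g[OF x] c d(1) \<eta>
          by (intro frac_le mult_mono mult_pos_pos) (auto simp: dist_norm less_imp_le)
        also have "\<dots> = \<epsilon> / 2" using c d(1) by (simp add: \<eta>_def)
        finally have "norm (of_real c / g x - of_real c / ?z) \<le> \<epsilon> / 2" .
        moreover have "norm (?y - (x - of_real \<tau> - of_real c / g x)) =
            norm ((?y - (x - of_real \<tau> - of_real c / ?z)) + (of_real c / g x - of_real c / ?z))"
          by (rule arg_cong[where f = norm]) simp
        ultimately have "norm (?y - (x - of_real \<tau> - of_real c / g x)) < \<epsilon>"
          using e norm_triangle_ineq[of "?y - (x - of_real \<tau> - of_real c / ?z)" "of_real c / g x - of_real c / ?z"]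
          by linarith
        then show "dist ?y (x - of_real \<tau> - of_real c / g x) < \<epsilon>" by (simp only: dist_norm)
      qed
    qed
  qed
  then show ?thesis by (simp add: g_def m_def c_def)
qed

lemma floor_index_proportional:
  assumes r: "r \<ge> 1" and q: "\<And>j. j \<in> {1..r} \<Longrightarrow> 0 < q j" and q_sum: "(\<Sum>j=1..r. q j) = 1"
  shows "proportional_family (ratio_filter t) snd (\<lambda>p. floor_index q (fst p)) r (q r * t) t"
proof -
  let ?F = "ratio_filter t"
  have "filterlim (\<lambda>p. (fst p, snd p)) ?F ?F" by (simp add: filterlim_ident)
  then have n: "filterlim fst sequentially ?F" and N: "filterlim snd sequentially ?F"
    and t: "((\<lambda>p. real (fst p) / real (snd p)) \<longlongrightarrow> t) ?F"
    unfolding filterlim_ratio_filter_iff by auto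
  have floor: "((\<lambda>p. real (floor_index q (fst p) j) / real (snd p)) \<longlongrightarrow> q j * t) ?F" if "j \<in> {1..r}" for j
  proof -
    have qj: "q j > 0" using q[OF that] .
    have "(\<lambda>n. real_of_int \<lfloor>q j * real n\<rfloor> / real n) \<longlonglongrightarrow> q j" using qj by real_asymp
    then have "(\<lambda>n. real (floor_index q n j) / real n) \<longlonglongrightarrow> q j"
      using qj by (simp add: floor_index_def)
    from tendsto_mult[OF filterlim_compose[OF this n] t]
    have "((\<lambda>p. real (floor_index q (fst p) j) / real (fst p) * (real (fst p) / real (snd p))) \<longlongrightarrow> q j * t) ?F" .
    moreover have "\<forall>\<^sub>F p in ?F. fst p > 0"
      using eventually_compose_filterlim[OF eventually_gt_at_top n] .
    then have "\<forall>\<^sub>F p in ?F. real (floor_index q (fst p) j) / real (fst p) * (real (fst p) / real (snd p)) =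
        real (floor_index q (fst p) j) / real (snd p)"
      by eventually_elim simp
    ultimately show ?thesis by (rule Lim_transform_eventually)
  qed
  have "((\<lambda>p. \<Sum>j=1..r. real (floor_index q (fst p) j) / real (snd p)) \<longlongrightarrow> (\<Sum>j=1..r. q j * t)) ?F"
    by (intro tendsto_sum floor)
  then have "((\<lambda>p. real (\<Sum>j=1..r. floor_index q (fst p) j) / real (snd p)) \<longlongrightarrow> t) ?F"
    by (simp add: sum_divide_distrib sum_distrib_right[symmetric] q_sum[simplified])
  then show ?thesis
    unfolding proportional_family_def using N floor[of r] r by simp
qed

lemma inj_on_scaled_params:
  assumes pos: "\<forall>j\<in>{1..r}. a j > 0" and r: "r \<ge> 1" and inj: "inj_on a {1..<r}"
  shows "\<forall>\<^sub>F N in sequentially. inj_on (scaled_params r a N) {1..r}"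
proof -
  have "a r > 0" using pos r by simp
  have "\<forall>\<^sub>F N in sequentially. a j < real N * a r" for j
  proof -
    have "filterlim (\<lambda>N. real N * a r) at_top sequentially"
      using \<open>a r > 0\<close> by real_asymp
    then show ?thesis by (simp add: filterlim_at_top_dense)
  qed
  then have "\<forall>\<^sub>F N in sequentially. \<forall>j\<in>{1..<r}. a j < real N * a r"
    by (intro eventually_ball_finite) auto
  then show ?thesis
  proof eventually_elim
    case (elim N)
    have "{1..r} = insert r {1..<r}" using r by auto
    moreover have "inj_on (scaled_params r a N) {1..<r}"
      using inj by (auto simp: inj_on_def scaled_params_def)
    moreover have "scaled_params r a N r \<notin> scaled_params r a N ` {1..<r}"
      using elim by (force simp: scaled_params_def)
    ultimately show ?case by simp
  qed
qed

lemma charlier_ratio_eq_scaled_quot: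
  assumes "\<forall>j\<in>{1..r}. a j > 0" "N > 0" "inj_on (scaled_params r a N) {1..r}"
  shows "charlier_ratio r a q k n N x = scaled_quot r a N (floor_index q n) k x"
proof -
  have "multiple_charlier r (scaled_params r a N) n = charlier r (scaled_params r a N) n" for n
    using scaled_params_pos[OF assms(1,2)] by (intro multiple_charlier_eq assms(3)) blast
  then show ?thesis
    by (simp add: charlier_ratio_def scaled_quot_def charlier_quot_def mult.commute)
qed

theorem theorem5p1:
  fixes r :: nat and a q :: "nat \<Rightarrow> real" and t :: real
  assumes a_pos: "\<And>j. j \<in> {1..r} \<Longrightarrow> a j > 0"
    and a_distinct: "inj_on a {1..<r}"
    and q_bounds: "\<And>j. j \<in> {1..r} \<Longrightarrow> 0 < q j \<and> q j < 1"
    and q_sum: "(\<Sum>j=1..r. q j) = 1"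
    and t_pos: "t > 0"
  shows "(\<forall>K. compact K \<and> K \<subseteq> - complex_of_real ` {0..} \<longrightarrow>
            uniform_limit K (\<lambda>(n, N). charlier_ratio r a q r n N)
              (g_limit r a q t) (ratio_filter t)) \<and>
         (\<forall>k\<in>{1..<r}. \<forall>K. compact K \<and> K \<subseteq> - complex_of_real ` {0..} \<longrightarrow>
            uniform_limit K (\<lambda>(n, N). charlier_ratio r a q k n N)
              (\<lambda>x. x - of_real t - of_real (a r * q r * t) / g_limit r a q t x) (ratio_filter t))"
proof -
  let ?F = "ratio_filter t" and ?\<nu> = "\<lambda>p::nat \<times> nat. floor_index q (fst p)"
  have pos: "\<forall>j\<in>{1..r}. a j > 0" using a_pos by blast
  have r: "r \<ge> 1" using q_sum by (cases r) auto
  then have qr: "0 < q r" "q r < 1" using q_bounds[of r] by auto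
  have \<rho>: "0 < q r * t" "q r * t < t" using qr t_pos by auto
  have fam: "proportional_family ?F snd ?\<nu> r (q r * t) t"
    by (rule floor_index_proportional) (use r q_bounds q_sum in auto)
  have g: "g_limit r a q t = joukowski_inverse (a r + t) (q r * t * a r)"
    by (rule ext) (simp add: g_limit_def joukowski_inverse_def mult_ac diff_diff_eq)
  have "filterlim snd sequentially ?F" using fam by (simp add: proportional_family_def)
  from eventually_compose_filterlim[OF inj_on_scaled_params[OF pos r a_distinct] this]
    proportional_family_pos[OF fam]
  have eq: "\<forall>\<^sub>F p in ?F. \<forall>k. \<forall>x. scaled_quot r a (snd p) (?\<nu> p) k x =
      (case p of (n, N) \<Rightarrow> charlier_ratio r a q k n N) x"
    by eventually_elim (auto simp: charlier_ratio_eq_scaled_quot[OF pos] split: prod.split)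
  have transfer: "uniform_limit K (\<lambda>(n, N). charlier_ratio r a q k n N) l ?F"
    if "uniform_limit K (\<lambda>p. scaled_quot r a (snd p) (?\<nu> p) k) l ?F" for K k l
  proof -
    have "\<forall>\<^sub>F p in ?F. \<forall>x\<in>K. scaled_quot r a (snd p) (?\<nu> p) k x =
        (case p of (n, N) \<Rightarrow> charlier_ratio r a q k n N) x"
      using eq by eventually_elim blast
    then show ?thesis using uniform_limit_cong that by fast
  qed
  show ?thesis
  proof (intro conjI allI impI ballI; elim conjE)
    fix K :: "complex set" assume K: "compact K" "K \<subseteq> - complex_of_real ` {0..}"
    show "uniform_limit K (\<lambda>(n, N). charlier_ratio r a q r n N) (g_limit r a q t) ?F"
      unfolding g by (rule transfer[OF scaled_quot_tendsto[OF pos r \<rho> K fam]])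
  next
    fix k K assume k: "k \<in> {1..<r}" and K: "compact K" "K \<subseteq> - complex_of_real ` {0..}"
    have c: "a r * q r * t = q r * t * a r" by simp
    show "uniform_limit K (\<lambda>(n, N). charlier_ratio r a q k n N)
        (\<lambda>x. x - of_real t - of_real (a r * q r * t) / g_limit r a q t x) ?F"
      unfolding g c by (rule transfer[OF scaled_quot_tendsto_other[OF pos k \<rho> K fam]])
  qed
qed

end
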